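(* For every positive integer $n$ (with $n\ge 2$) and every simple undirected graph $G$ on $n$ vertices, \[ \lambda_1(G)+\lambda_2(G)\le \frac{8}{7}\,n . \]
   Context: For a simple undirected graph $G$ on $n$ vertices, $\lambda_1(G)\ge\lambda_2(G)\ge\cdots\ge\lambda_n(G)$ denote the eigenvalues (with multiplicity) of its adjacency matrix $A(G)=[a_{ij}]$, where $a_{ij}=1$ if $i$ and $j$ are adjacent and $a_{ij}=0$ otherwise. *)

theory Defs
  imports "Graph_Theory.Digraph" "Jordan_Normal_Form.Char_Poly" "HOL-Library.Multiset"
begin

text \<open>A finite simple undirected graph is the locale \<open>graph\<close> of \<open>Graph_Theory\<close>: a finite loop-free
  digraph without parallel arcs whose arc relation is symmetric, so that each undirected edge is
  represented by its two orientations.\<close>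

definition adjacency_matrix :: "('a, 'b) pre_digraph \<Rightarrow> 'a list \<Rightarrow> real mat" where
  "adjacency_matrix G vs =
     mat (length vs) (length vs) (\<lambda>(i, j). if vs ! i \<rightarrow>\<^bsub>G\<^esub> vs ! j then 1 else 0)"

definition enumerates_verts :: "('a, 'b) pre_digraph \<Rightarrow> 'a list \<Rightarrow> bool" where
  "enumerates_verts G vs \<longleftrightarrow> distinct vs \<and> set vs = verts G"

text \<open>The eigenvalues in decreasing order, each repeated according to its multiplicity as a root of
  the characteristic polynomial. The chosen enumeration of the vertices is irrelevant, and there are
  exactly as many eigenvalues as vertices; see \<open>graph_spectrum_eq\<close> and
  \<open>length_graph_spectrum\<close> below.\<close>

definition graph_spectrum :: "('a, 'b) pre_digraph \<Rightarrow> real list" where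
  "graph_spectrum G =
     rev (sorted_list_of_multiset
       (proots (char_poly (adjacency_matrix G (SOME vs. enumerates_verts G vs)))))"

text \<open>\<open>graph_eigenvalue G k\<close> is the \<open>k\<close>-th largest eigenvalue, counting from 1; it is only
  meaningful for \<open>k\<close> between 1 and the number of vertices.\<close>

definition graph_eigenvalue :: "('a, 'b) pre_digraph \<Rightarrow> nat \<Rightarrow> real" where
  "graph_eigenvalue G k = graph_spectrum G ! (k - 1)"

lemma adjacency_matrix_carrier:
  "adjacency_matrix G vs \<in> carrier_mat (length vs) (length vs)"
  by (simp add: adjacency_matrix_def)

lemma char_poly_adjacency_matrix_cong:
  assumes vs: "enumerates_verts G vs" and ws: "enumerates_verts G ws"
  shows "char_poly (adjacency_matrix G vs) = char_poly (adjacency_matrix G ws)"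
proof -
  define n where "n = length vs"
  have dv: "distinct vs" and dw: "distinct ws" and sets: "set vs = set ws"
    using vs ws by (auto simp: enumerates_verts_def)
  have lw: "length ws = n"
    unfolding n_def using dv dw sets by (metis distinct_card)
  have "\<exists>j<n. ws ! j = vs ! i" if "i < n" for i
    using that sets lw unfolding n_def by (metis in_set_conv_nth)
  then obtain s where s: "\<And>i. i < n \<Longrightarrow> s i < n" "\<And>i. i < n \<Longrightarrow> ws ! s i = vs ! i"
    by metis
  have eq: "vs ! i = ws ! k \<longleftrightarrow> k = s i" if "i < n" "k < n" for i k
    using s[OF that(1)] that dw lw by (metis nth_eq_iff_index_eq)
  define P :: "real mat" where "P = mat n n (\<lambda>(i, j). if j = s i then 1 else 0)"
  let ?A = "adjacency_matrix G vs" and ?B = "adjacency_matrix G ws"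
  let ?Q = "transpose_mat P"
  have A: "?A \<in> carrier_mat n n" and B: "?B \<in> carrier_mat n n"
    using adjacency_matrix_carrier[of G vs] adjacency_matrix_carrier[of G ws] lw n_def by auto
  have P: "P \<in> carrier_mat n n" by (simp add: P_def)
  have left: "(P * M) $$ (i, j) = M $$ (s i, j)"
    if "M \<in> carrier_mat n n" "i < n" "j < n" for M i j
  proof -
    have "(P * M) $$ (i, j) = (\<Sum>k = 0..<n. (if k = s i then 1 else 0) * M $$ (k, j))"
      using that by (simp add: P_def scalar_prod_def)
    also have "\<dots> = (\<Sum>k = 0..<n. if k = s i then M $$ (k, j) else 0)"
      by (rule sum.cong) auto
    also have "\<dots> = M $$ (s i, j)" using s(1)[OF that(2)] by (simp add: sum.delta')
    finally show ?thesis .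
  qed
  have right: "(M * ?Q) $$ (i, j) = M $$ (i, s j)"
    if "M \<in> carrier_mat n n" "i < n" "j < n" for M i j
  proof -
    have "(M * ?Q) $$ (i, j) = (\<Sum>k = 0..<n. M $$ (i, k) * (if k = s j then 1 else 0))"
      using that by (simp add: P_def scalar_prod_def)
    also have "\<dots> = (\<Sum>k = 0..<n. if k = s j then M $$ (i, k) else 0)"
      by (rule sum.cong) auto
    also have "\<dots> = M $$ (i, s j)" using s(1)[OF that(3)] by (simp add: sum.delta')
    finally show ?thesis .
  qed
  have inj: "s i = s j \<longleftrightarrow> i = j" if "i < n" "j < n" for i j
    using s that dv n_def by (metis nth_eq_iff_index_eq)
  have PQ: "P * ?Q = 1\<^sub>m n"
  proof (rule eq_matI)
    fix i j assume ij: "i < dim_row (1\<^sub>m n :: real mat)" "j < dim_col (1\<^sub>m n :: real mat)"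
    then have "(P * ?Q) $$ (i, j) = P $$ (i, s j)" using right[OF P] by simp
    also have "\<dots> = (1\<^sub>m n) $$ (i, j)" using ij s(1) inj by (auto simp: P_def)
    finally show "(P * ?Q) $$ (i, j) = (1\<^sub>m n) $$ (i, j)" .
  qed (use P in auto)
  have QP: "?Q * P = 1\<^sub>m n"
    using mat_mult_left_right_inverse[OF P _ PQ] P by simp
  have "?A = P * ?B * ?Q"
  proof (rule eq_matI)
    fix i j assume "i < dim_row (P * ?B * ?Q)" "j < dim_col (P * ?B * ?Q)"
    then have ij: "i < n" "j < n" using P by auto
    have "(P * ?B * ?Q) $$ (i, j) = (P * ?B) $$ (i, s j)"
      using right[of "P * ?B"] P B ij by simp
    also have "\<dots> = ?B $$ (s i, s j)" using left[OF B ij(1)] s(1)[OF ij(2)] by simp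
    also have "\<dots> = ?A $$ (i, j)"
      using ij s lw n_def by (simp add: adjacency_matrix_def)
    finally show "?A $$ (i, j) = (P * ?B * ?Q) $$ (i, j)" by simp
  qed (use P A in auto)
  then have "similar_mat ?A ?B"
    by (intro similar_matI[of _ _ P ?Q n]) (use A B P PQ QP in auto)
  then show ?thesis by (rule char_poly_similar)
qed

lemma graph_spectrum_eq:
  assumes "enumerates_verts G vs"
  shows "graph_spectrum G =
    rev (sorted_list_of_multiset (proots (char_poly (adjacency_matrix G vs))))"
  unfolding graph_spectrum_def
  using char_poly_adjacency_matrix_cong[OF someI[of "enumerates_verts G", OF assms] assms] by simp

lemma eigenvalue_real_symmetric:
  fixes A :: "real mat"
  assumes A: "A \<in> carrier_mat n n"
    and sym: "\<And>i j. i < n \<Longrightarrow> j < n \<Longrightarrow> A $$ (i, j) = A $$ (j, i)"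
    and ev: "eigenvalue (map_mat complex_of_real A) c"
  shows "c \<in> \<real>"
proof -
  let ?C = "map_mat complex_of_real A"
  obtain v where v: "v \<in> carrier_vec n" "v \<noteq> 0\<^sub>v n" "?C *\<^sub>v v = c \<cdot>\<^sub>v v"
    using ev A unfolding eigenvalue_def eigenvector_def by auto
  define S where "S = (\<Sum>i<n. cnj (v $ i) * (\<Sum>j<n. complex_of_real (A $$ (i, j)) * v $ j))"
  define N where "N = (\<Sum>i<n. (cmod (v $ i))\<^sup>2)"
  have row: "(\<Sum>j<n. complex_of_real (A $$ (i, j)) * v $ j) = c * v $ i" if "i < n" for i
  proof -
    have "(?C *\<^sub>v v) $ i = (\<Sum>j<n. complex_of_real (A $$ (i, j)) * v $ j)"
      using A v(1) that by (simp add: scalar_prod_def atLeast0LessThan)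
    then show ?thesis using v that by simp
  qed
  have "S = (\<Sum>i<n. c * complex_of_real ((cmod (v $ i))\<^sup>2))"
    unfolding S_def by (rule sum.cong) (simp, simp only: row lessThan_iff, simp only: complex_norm_square ac_simps)
  then have SN: "S = c * complex_of_real N"
    by (simp add: N_def sum_distrib_left)
  have "cnj S = (\<Sum>i<n. \<Sum>j<n. v $ i * (complex_of_real (A $$ (i, j)) * cnj (v $ j)))"
    by (simp add: S_def sum_distrib_left)
  also have "\<dots> = (\<Sum>j<n. \<Sum>i<n. v $ i * (complex_of_real (A $$ (i, j)) * cnj (v $ j)))"
    by (rule sum.swap)
  also have "\<dots> = S"
    unfolding S_def sum_distrib_left by (intro sum.cong refl) (simp add: sym)
  finally have "cnj c * complex_of_real N = c * complex_of_real N" using SN by simp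
  moreover have "N \<noteq> 0"
  proof
    assume "N = 0"
    then have "\<forall>i<n. v $ i = 0" unfolding N_def by (subst (asm) sum_nonneg_eq_0_iff) auto
    then show False using v(1,2) by auto
  qed
  ultimately show ?thesis by (simp add: Reals_cnj_iff)
qed

lemma size_proots_real_symmetric:
  fixes A :: "real mat"
  assumes A: "A \<in> carrier_mat n n"
    and sym: "\<And>i j. i < n \<Longrightarrow> j < n \<Longrightarrow> A $$ (i, j) = A $$ (j, i)"
  shows "size (proots (char_poly A)) = n"
proof -
  let ?C = "map_mat complex_of_real A"
  have C: "?C \<in> carrier_mat n n" using A by simp
  interpret P: map_poly_inj_idom_hom complex_of_real ..
  obtain as where as: "char_poly ?C = (\<Prod>a\<leftarrow>as. [:- a, 1:])" "length as = n"
    using char_poly_factorized[OF C] by blast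
  have "a \<in> \<real>" if "a \<in> set as" for a
  proof -
    have "poly (char_poly ?C) a = 0"
      using that by (auto simp: as(1) poly_prod_list prod_list_zero_iff)
    then show ?thesis
      using eigenvalue_real_symmetric[OF A sym] eigenvalue_root_char_poly[OF C] by blast
  qed
  then obtain rs where rs: "as = map complex_of_real rs"
    by (metis ex_map_conv Reals_cases)
  have "map_poly complex_of_real (char_poly A) = char_poly ?C"
    by (simp add: of_real_hom.char_poly_hom[OF A])
  also have "\<dots> = map_poly complex_of_real (\<Prod>a\<leftarrow>rs. [:- a, 1:])"
  proof -
    have "map_poly complex_of_real (\<Prod>a\<leftarrow>rs. [:- a, 1:]) =
        (\<Prod>a\<leftarrow>map complex_of_real rs. [:- a, 1:])"
      by (induction rs) (simp_all add: P.hom_mult del: mult_pCons_left)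
    then show ?thesis by (simp only: as(1) rs)
  qed
  finally have "char_poly A = (\<Prod>a\<leftarrow>rs. [:- a, 1:])"
    by (simp only: P.eq_iff)
  moreover have "proots (\<Prod>a\<leftarrow>rs. [:- a, 1:]) = mset rs"
  proof (induction rs)
    case (Cons r rs)
    have "(\<Prod>a\<leftarrow>rs. [:- a, 1:]) \<noteq> 0" by (auto simp: prod_list_zero_iff)
    then have "proots ([:- r, 1:] * (\<Prod>a\<leftarrow>rs. [:- a, 1:])) = {#r#} + mset rs"
      by (subst proots_mult) (simp_all add: Cons.IH)
    then show ?case by simp
  qed simp
  ultimately show ?thesis using as(2) rs by simp
qed

lemma length_graph_spectrum:
  assumes "graph G"
  shows "length (graph_spectrum G) = card (verts G)"
proof -
  interpret graph G by fact
  obtain vs where vs: "enumerates_verts G vs"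
    using finite_distinct_list[OF finite_verts] by (auto simp: enumerates_verts_def)
  let ?A = "adjacency_matrix G vs"
  have "?A $$ (i, j) = ?A $$ (j, i)" if "i < length vs" "j < length vs" for i j
    using that sym_arcs by (auto simp: adjacency_matrix_def symmetric_def sym_def)
  then have "size (proots (char_poly ?A)) = length vs"
    by (intro size_proots_real_symmetric adjacency_matrix_carrier)
  then have "length (graph_spectrum G) = length vs"
    by (metis graph_spectrum_eq[OF vs] length_rev mset_sorted_list_of_multiset size_mset)
  then show ?thesis
    using vs by (metis enumerates_verts_def distinct_card)
qed

end

theory Submission
  imports Defs "HOL-Analysis.Function_Topology" "HOL-Analysis.Convex"
    "Jordan_Normal_Form.Schur_Decomposition"
begin

text \<open>
  Since \<open>A(G)\<close> is symmetric, \<open>\<lambda>\<^sub>1 + \<lambda>\<^sub>2\<close> is its trace on a plane spanned by an orthonormal pair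
  \<open>\<xi>\<close>, \<open>\<zeta>\<close>, so it equals \<open>\<Sum>i j. A i j * (\<xi> i * \<xi> j + \<zeta> i * \<zeta> j)\<close>. The entries of \<open>A(G)\<close> are 0 or 1;
  keeping only the positive terms gives an upper bound in which the graph no longer occurs. Allowing
  weights on the vertices as well, one has to show that \<open>energy I s \<xi> \<zeta> \<le> 8/7\<close> for all unit vectors \<open>s\<close>
  and all orthonormal pairs (\<open>energy_le\<close>). The relaxation pays off because all variables are now
  continuous: a maximum exists, and the first-order conditions there are strong.

  At a maximum, place vertex \<open>i\<close> at \<open>(x i, z i) = (\<xi> i / s i, \<zeta> i / s i)\<close> with weight \<open>(s i)^2\<close> and join two
  vertices iff the inner product of their points is nonnegative. Criticality in the pair makes \<open>x\<close> and
  \<open>z\<close> eigenfunctions of this weighted graph, with eigenvalues \<open>l \<ge> t\<close>; criticality in the weights puts all points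
  on the ellipse \<open>l * x^2 + t * z^2 = l + t\<close>. If \<open>l + t > 8/7\<close>, then \<open>x\<close> can be taken nonnegative, since a
  top eigenfunction of mixed sign would split the weight and force \<open>l \<le> 1/2\<close>. These are the assumptions of
  \<open>weighted_optimum\<close>. Nonadjacent pairs then occur only between a set \<open>P\<close> with large \<open>z\<close> and a set \<open>Q\<close> with
  negative \<open>z\<close>; the remaining vertices form a class \<open>B\<close> at one point. By the shape of the ellipse the
  extreme vertex of \<open>P\<close> misses all of \<open>Q\<close> and vice versa (\<open>extreme_vertices\<close>), which determines the first
  and second moments of \<open>P\<close> and \<open>Q\<close> almost completely.

  The extremal picture is \<open>P\<close> and \<open>Q\<close> of weight \<open>2/7\<close> each without edges between them, and \<open>B\<close> of weight
  \<open>3/7\<close>; its eigenvalues are \<open>6/7\<close>, \<open>2/7\<close>, \<open>- 1/7\<close>. In general, concentrating \<open>P\<close> and \<open>Q\<close> at their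
  extreme values and at \<open>B\<close>, with first moments kept, produces a model with three classes. There \<open>t\<close> is exactly an
  eigenvalue, and a tent-shaped test function shows that its characteristic polynomial is at most 0 at \<open>l\<close>
  (\<open>tent_bound\<close>). The three eigenvalues of the model add up to 1, so it suffices that its
  characteristic polynomial is at most 0 at \<open>- 1/7\<close>. For a balanced model this is the inequality
  \<open>a\<^sub>0 * c\<^sub>0 * (6/7 - a\<^sub>0 - c\<^sub>0) \<le> (2/7)^3\<close> between means. The imbalance has the favourable sign by
  \<open>spread_gap\<close>: the equation of the ellipse gives the difference of the weights of \<open>P\<close> and \<open>Q\<close>
  (\<open>weight_gap\<close>), and a polynomial inequality remains (\<open>tent_gap_inequality\<close>). Its range of parameters comes
  from the Frobenius norm (\<open>frobenius_gap\<close>) and from Cauchy--Schwarz (\<open>Y_lower\<close>).\<close>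

section \<open>A polynomial inequality\<close>

text \<open>Polynomials on the unit interval are shown to be nonnegative through their coefficients in the
  Bernstein basis.\<close>

lemma bernstein5_nonneg:
  fixes s :: real
  assumes "0 \<le> s" "s \<le> 1" "0 \<le> c0" "0 \<le> c1" "0 \<le> c2" "0 \<le> c3" "0 \<le> c4" "0 \<le> c5"
  shows "0 \<le> c0 * (1 - s)^5 + c1 * (s * (1 - s)^4) + c2 * (s^2 * (1 - s)^3)
            + c3 * (s^3 * (1 - s)^2) + c4 * (s^4 * (1 - s)) + c5 * s^5"
  using assms by (intro add_nonneg_nonneg mult_nonneg_nonneg zero_le_power) auto

text \<open>The difference of the two sides is a nonnegative term plus \<open>y\<close> times a cubic \<open>H\<close> in \<open>y\<close>. Bounding
  \<open>y^3\<close> from below by its tangent \<open>12 * y - 16\<close> at \<open>y = 2\<close> leaves a quadratic that is concave in \<open>y\<close>,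
  hence at least its chord over \<open>[0, 7 - 2 * T]\<close>. Only the two endpoint values \<open>E0\<close> and \<open>E1\<close> remain:
  quintics in \<open>T\<close> with positive Bernstein coefficients on \<open>[3/2, 5/2]\<close>.\<close>

lemma bivariate_polynomial_nonneg:
  fixes T y :: real
  assumes T: "3/2 \<le> T" "T \<le> 5/2" and y: "0 \<le> y" "y \<le> 7 - 2 * T"
  defines "L \<equiv> 7 * (4 - T) * (8 * T - T^2 + 8 * y)"
    and "R \<equiv> 2 * (8 - T + y) * (7 * T + 7 * y + T * y - y^2 - 2 * T^2)"
    and "\<sigma> \<equiv> (2 * T - 3) * (5 - 2 * T)"
  shows "\<sigma> * (T + 2 * y) * L \<le> 2 * T * (\<sigma> + 4 * T * y) * (L - R)"
proof -
  define s where "s = T - 3/2"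
  have s: "0 \<le> s" "s \<le> 1" and Ts: "T = 3/2 + s" using T by (auto simp: s_def)
  define m where "m = 7 - 2 * T"
  have m: "m > 0" "y \<le> m" using T y by (auto simp: m_def)
  define E0 where "E0 = 6720*T - 8624*T^2 + 3998*T^3 - 656*T^4 + 32*T^5"
  define E1 where "E1 = 47040 - 72016*T + 48784*T^2 - 18722*T^3 + 3904*T^4 - 320*T^5"
  define K where "K = 48*T^3 - 80*T^2 + 60*T"
  have E0: "0 \<le> E0"
  proof -
    have "E0 = 4365/4 * (1 - s)^5 + 20979/4 * (s * (1 - s)^4) + 23315/2 * (s^2 * (1 - s)^3)
        + 30397/2 * (s^3 * (1 - s)^2) + 42125/4 * (s^4 * (1 - s)) + 11475/4 * s^5"
      unfolding E0_def Ts by Groebner_Basis.algebra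
    then show ?thesis using bernstein5_nonneg[OF s, of "4365/4" "20979/4" "23315/2" "30397/2" "42125/4" "11475/4"] by simp
  qed
  have E1: "0 \<le> E1"
  proof -
    have "E1 = 11709/4 * (1 - s)^5 + 28811/4 * (s * (1 - s)^4) + 11955/2 * (s^2 * (1 - s)^3)
        + 2981/2 * (s^3 * (1 - s)^2) + 2909/4 * (s^4 * (1 - s)) + 2475/4 * s^5"
      unfolding E1_def Ts by Groebner_Basis.algebra
    then show ?thesis
      using bernstein5_nonneg[OF s, of "11709/4" "28811/4" "11955/2" "2981/2" "2909/4" "2475/4"]
      by simp
  qed
  have K: "0 \<le> K"
  proof -
    have "K = T * (12 * (2*T - 5/3)^2 + 80/3)" unfolding K_def by Groebner_Basis.algebra
    then show ?thesis using T by simp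
  qed
  define F1 where "F1 = 6720*T - 8368*T^2 + 3998*T^3 - 656*T^4 + 32*T^5"
  define F2 where "F2 = 6720 - 8908*T + 4664*T^2 - 1168*T^3 + 80*T^4"
  define H where "H = F1 + F2 * y - K * y^2 + 16 * T^2 * y^3"
  \<comment> \<open>Chord of the concave quadratic, plus its excess \<open>K * y * (m - y)\<close> over the chord, plus the
    excess of \<open>y^3\<close> over its tangent: \<open>y^3 - 12 * y + 16 = (y - 2)^2 * (y + 4)\<close>.\<close>
  have "m * H =
      (m - y) * E0 + y * E1 + K * (m * y * (m - y)) + 16 * T^2 * (m * ((y - 2)^2 * (y + 4)))"
    unfolding H_def E0_def E1_def K_def m_def F1_def F2_def
    by (simp add: algebra_simps power2_eq_square power3_eq_cube power4_eq_xxxx power_numeral_reduce)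
  also have "\<dots> \<ge> 0"
    using E0 E1 K m y T by (intro add_nonneg_nonneg mult_nonneg_nonneg) auto
  finally have "0 \<le> H" using m(1) by (simp add: zero_le_mult_iff)
  then have "0 \<le> T^3 * (8 - T) * \<sigma> + y * H"
    using y T by (intro add_nonneg_nonneg mult_nonneg_nonneg) (auto simp: \<sigma>_def)
  also have "\<dots> = 2 * T * (\<sigma> + 4 * T * y) * (L - R) - \<sigma> * (T + 2 * y) * L"
    unfolding L_def R_def \<sigma>_def H_def F1_def F2_def K_def
    by (simp add: algebra_simps power2_eq_square power3_eq_cube power4_eq_xxxx power_numeral_reduce)
  finally show ?thesis by simp
qed

text \<open>The analytic fact behind \<open>spread_gap\<close>, where \<open>e\<close> is \<open>t * \<delta>^2\<close>. The right-hand side grows with \<open>l\<close>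
  and the lower bound for \<open>X\<close> shrinks as \<open>e\<close> grows, so the worst case has \<open>l + t = 8/7\<close> and \<open>e\<close> as large
  as the bound on \<open>e * b\<close> permits. That case depends on \<open>t\<close> and \<open>b\<close> only; scaled by 7, it is
  \<open>bivariate_polynomial_nonneg\<close>.\<close>

lemma tent_gap_inequality:
  fixes t l b e X :: real
  assumes t: "3/14 < t" "t < 5/14" and b: "0 \<le> b" "b \<le> 1 - 2 * t" and e: "0 \<le> e" "e \<le> 1"
    and S: "8/7 \<le> l + t"
    and eb: "4 * t * e * b \<le> (1 - e) * ((2 * t - 3/7) * (5/7 - 2 * t))"
    and X: "1 - e + e * (b / t - 1)^2 / 2 \<le> X"
  shows "(t + b) * (1 - b) / 2 - t * (t - b) \<le> X * ((l - t) * (l * t / (l + t) + b) / (l + b))"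
proof -
  define l0 where "l0 = 8/7 - t"
  define T where "T = 7 * t"
  define y where "y = 7 * b"
  define L where "L = 7 * (4 - T) * (8 * T - T^2 + 8 * y)"
  define R where "R = 2 * (8 - T + y) * (7 * T + 7 * y + T * y - y^2 - 2 * T^2)"
  define \<sigma> where "\<sigma> = (2 * T - 3) * (5 - 2 * T)"
  have t0: "t > 0" using t by simp
  have l0: "l0 \<le> l" "l0 > t" "l0 > 0" using S t by (auto simp: l0_def)
  have T: "3/2 < T" "T < 5/2" and y: "0 \<le> y" "y \<le> 7 - 2 * T"
    using t b by (auto simp: T_def y_def)
  have L: "L \<ge> 0"
  proof -
    have "8 * T - T^2 = T * (8 - T)" by Groebner_Basis.algebra
    then show ?thesis using T y by (simp add: L_def)
  qed
  have \<sigma>: "\<sigma> > 0" using T by (simp add: \<sigma>_def)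
  have eT: "e * (\<sigma> + 4 * T * y) \<le> \<sigma>"
    using eb by (simp add: T_def y_def \<sigma>_def field_simps)
  \<comment> \<open>Dropping \<open>e * (b / t)^2 / 2\<close> makes the bound for \<open>X\<close> linear in \<open>b\<close>.\<close>
  have XT: "1 - e * (T + 2 * y) / (2 * T) \<le> X"
  proof -
    have "1 - e + e * (b / t - 1)^2 / 2 - (1 - e * (T + 2 * y) / (2 * T)) = e * (b / t)^2 / 2"
      using t0 by (simp add: T_def y_def field_simps power2_eq_square)
    also have "\<dots> \<ge> 0" using e by simp
    finally show ?thesis using X by simp
  qed
  have p: "\<sigma> + 4 * T * y > 0" using \<sigma> T y by (intro add_pos_nonneg) auto
  have "e * (T + 2 * y) * L * (\<sigma> + 4 * T * y) = (e * (\<sigma> + 4 * T * y)) * ((T + 2 * y) * L)" by simp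
  also have "\<dots> \<le> \<sigma> * ((T + 2 * y) * L)"
    using eT L T y by (intro mult_right_mono mult_nonneg_nonneg) auto
  also have "\<dots> \<le> 2 * T * (L - R) * (\<sigma> + 4 * T * y)"
    using bivariate_polynomial_nonneg[of T y, folded L_def R_def \<sigma>_def] T y by (simp only: mult_ac less_imp_le)
  finally have "e * (T + 2 * y) * L \<le> 2 * T * (L - R)"
    using p by simp
  then have "R \<le> (1 - e * (T + 2 * y) / (2 * T)) * L"
    using T by (simp add: field_simps)
  also have "\<dots> \<le> X * L" using XT L by (rule mult_right_mono)
  finally have XLR: "R \<le> X * L" .
  have X0: "0 \<le> X"
  proof -
    have "0 \<le> 1 - e + e * (b / t - 1)^2 / 2" using e by simp
    then show ?thesis using X by simp
  qed
  have "(t + b) * (1 - b) / 2 - t * (t - b) = R / (196 * (8 - T + y))"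
    using T y by (simp add: R_def T_def y_def field_simps power2_eq_square)
  also have "\<dots> \<le> X * L / (196 * (8 - T + y))"
    using XLR T y by (intro divide_right_mono) auto
  also have "\<dots> = X * ((l0 - t) / (l0 + b) * (l0 * t / (l0 + t) + b))"
    using T y t b by (simp add: L_def l0_def T_def y_def field_simps power2_eq_square)
  also have "\<dots> \<le> X * ((l - t) / (l + b) * (l * t / (l + t) + b))"
  proof (intro mult_left_mono mult_mono add_right_mono X0)
    show "(l0 - t) / (l0 + b) \<le> (l - t) / (l + b)"
    proof -
      have "(l0 - t) * (l + b) \<le> (l - t) * (l0 + b)"
        using mult_right_mono[OF l0(1), of "t + b"] t0 b by (simp add: algebra_simps)
      then show ?thesis using l0 b by (simp add: frac_le_eq divide_simps)
    qed
    show "l0 * t / (l0 + t) \<le> l * t / (l + t)"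
    proof -
      have "l0 * t * (l + t) \<le> l * t * (l0 + t)"
        using mult_right_mono[OF l0(1), of "t * t"] t0 by (simp add: algebra_simps)
      then show ?thesis using l0 t0 by (simp add: divide_simps)
    qed
  qed (use l0 t0 b in auto)
  finally show ?thesis by simp
qed

lemma square_sum_diff: "(a + c)^2 = 4 * ((a - d) * (c + d)) + ((a - d) - (c + d))^2" for a c d :: real
  by Groebner_Basis.algebra

section \<open>Critical weighted configurations\<close>

text \<open>The first-order conditions at a maximum of \<open>energy\<close> with value \<open>l + t\<close>, written in the
  coordinates of \<open>energy_le\<close>. The vertices carry weights \<open>w\<close> and sit at the points \<open>(x i, z i)\<close> of the
  plane; two vertices are adjacent iff the inner product of their points is nonnegative. The functions
  \<open>x\<close> and \<open>z\<close> are orthonormal eigenfunctions of the weighted adjacency operator (criticality in the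
  orthonormal pair), and all points lie on one ellipse (criticality in the weights). The sign of \<open>z\<close> is
  chosen by \<open>sum_z_nonneg\<close>. With \<open>8/7 < l + t\<close> these conditions turn out to be inconsistent.\<close>

locale weighted_optimum =
  fixes I :: "'a set" and w x z :: "'a \<Rightarrow> real" and l t :: real
  assumes finite_I: "finite I"
    and w_pos: "\<And>i. i \<in> I \<Longrightarrow> 0 < w i"
    and x_nonneg: "\<And>i. i \<in> I \<Longrightarrow> 0 \<le> x i"
    and sum_w: "(\<Sum>i\<in>I. w i) = 1"
    and sum_xx: "(\<Sum>i\<in>I. w i * (x i)^2) = 1"
    and sum_zz: "(\<Sum>i\<in>I. w i * (z i)^2) = 1"
    and sum_xz: "(\<Sum>i\<in>I. w i * (x i * z i)) = 0"
    and eigen_x: "\<And>i. i \<in> I \<Longrightarrow> l * x i = (\<Sum>j\<in>I. if 0 \<le> x i * x j + z i * z j then w j * x j else 0)"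
    and eigen_z: "\<And>i. i \<in> I \<Longrightarrow> t * z i = (\<Sum>j\<in>I. if 0 \<le> x i * x j + z i * z j then w j * z j else 0)"
    and ellipse: "\<And>i. i \<in> I \<Longrightarrow> l * (x i)^2 + t * (z i)^2 = l + t"
    and sum_z_nonneg: "0 \<le> (\<Sum>i\<in>I. w i * z i)"
    and large: "8/7 < l + t"
    and t_le_l: "t \<le> l"
begin

definition nonadj :: "'a \<Rightarrow> 'a set" where
  "nonadj i = {j \<in> I. x i * x j + z i * z j < 0}"

text \<open>The point \<open>(x\<^sub>B, \<delta>)\<close> is where the eigenvalue equations put every vertex that is adjacent to all
  vertices. Since \<open>x\<close> is nonnegative, nonadjacency requires \<open>z\<close> of opposite signs; it will only occur
  between \<open>P\<close> and \<open>Q\<close>.\<close>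

definition x\<^sub>B :: real where "x\<^sub>B = (\<Sum>i\<in>I. w i * x i) / l"
definition \<delta> :: real where "\<delta> = (\<Sum>i\<in>I. w i * z i) / t"
definition P :: "'a set" where "P = {i \<in> I. \<delta> < z i}"
definition Q :: "'a set" where "Q = {i \<in> I. z i < 0}"

lemma nonadj_sym: "i \<in> I \<Longrightarrow> j \<in> nonadj i \<longleftrightarrow> j \<in> I \<and> i \<in> nonadj j"
  by (auto simp: nonadj_def mult.commute)

lemma l_pos: "0 < l"
  using large t_le_l by linarith

lemma sum_adjacent_eq:
  fixes f :: "'a \<Rightarrow> real"
  assumes "i \<in> I"
  shows "(\<Sum>j\<in>I. if 0 \<le> x i * x j + z i * z j then f j else 0) = (\<Sum>j\<in>I. f j) - (\<Sum>j\<in>nonadj i. f j)"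
proof -
  have "(\<Sum>j\<in>nonadj i. f j) = (\<Sum>j\<in>I. if x i * x j + z i * z j < 0 then f j else 0)"
    unfolding nonadj_def by (rule sum.inter_filter[OF finite_I])
  moreover have "(\<Sum>j\<in>I. f j) = (\<Sum>j\<in>I. (if 0 \<le> x i * x j + z i * z j then f j else 0)
      + (if x i * x j + z i * z j < 0 then f j else 0))"
    by (intro sum.cong refl) simp
  ultimately have "(\<Sum>j\<in>I. if 0 \<le> x i * x j + z i * z j then f j else 0) + (\<Sum>j\<in>nonadj i. f j) = (\<Sum>j\<in>I. f j)"
    by (simp only: sum.distrib)
  then show ?thesis by simp
qed

text \<open>The 0/1 kernel \<open>M\<close> of the adjacency relation has squared weighted Frobenius norm equal to the weight of
  adjacent pairs, and this norm is at least the sum of the squares of two eigenvalues: expand the squared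
  norm of \<open>M i j - l * x i * x j - t * z i * z j\<close>.\<close>

lemma frobenius:
  "l^2 + t^2 \<le> 1 - (\<Sum>i\<in>I. \<Sum>j\<in>nonadj i. w i * w j)"
proof -
  define M where "M i j = (if 0 \<le> x i * x j + z i * z j then 1 else 0 :: real)" for i j
  have MM: "(M i j)^2 = M i j" for i j by (simp add: M_def)
  have mx: "(\<Sum>j\<in>I. M i j * (w j * x j)) = l * x i" if "i \<in> I" for i
    using eigen_x[OF that] by (simp add: M_def if_distrib[of "\<lambda>c. c * _"] cong: if_cong)
  have mz: "(\<Sum>j\<in>I. M i j * (w j * z j)) = t * z i" if "i \<in> I" for i
    using eigen_z[OF that] by (simp add: M_def if_distrib[of "\<lambda>c. c * _"] cong: if_cong)
  have a1: "(\<Sum>i\<in>I. \<Sum>j\<in>I. w i * w j * M i j) = 1 - (\<Sum>i\<in>I. \<Sum>j\<in>nonadj i. w i * w j)"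
  proof -
    have "(\<Sum>j\<in>I. w i * w j * M i j) = w i - (\<Sum>j\<in>nonadj i. w i * w j)" if "i \<in> I" for i
      using sum_adjacent_eq[OF that, of "\<lambda>j. w i * w j"] sum_w
      by (simp add: M_def if_distrib[of "\<lambda>c. _ * c"] cong: if_cong flip: sum_distrib_left)
    then show ?thesis by (simp add: sum_subtractf sum_w)
  qed
  have a2: "(\<Sum>i\<in>I. \<Sum>j\<in>I. w i * w j * M i j * (x i * x j)) = l"
  proof -
    have "(\<Sum>j\<in>I. w i * w j * M i j * (x i * x j)) = w i * x i * (\<Sum>j\<in>I. M i j * (w j * x j))" for i
      by (simp add: sum_distrib_left mult_ac)
    then have "(\<Sum>i\<in>I. \<Sum>j\<in>I. w i * w j * M i j * (x i * x j)) = (\<Sum>i\<in>I. l * (w i * (x i)^2))"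
      using mx by (intro sum.cong) (auto simp: power2_eq_square)
    also have "\<dots> = l" using sum_xx by (simp flip: sum_distrib_left)
    finally show ?thesis .
  qed
  have a3: "(\<Sum>i\<in>I. \<Sum>j\<in>I. w i * w j * M i j * (z i * z j)) = t"
  proof -
    have "(\<Sum>j\<in>I. w i * w j * M i j * (z i * z j)) = w i * z i * (\<Sum>j\<in>I. M i j * (w j * z j))" for i
      by (simp add: sum_distrib_left mult_ac)
    then have "(\<Sum>i\<in>I. \<Sum>j\<in>I. w i * w j * M i j * (z i * z j)) = (\<Sum>i\<in>I. t * (w i * (z i)^2))"
      using mz by (intro sum.cong) (auto simp: power2_eq_square)
    also have "\<dots> = t" using sum_zz by (simp flip: sum_distrib_left)
    finally show ?thesis .
  qed
  have prod: "(\<Sum>i\<in>I. \<Sum>j\<in>I. (w i * f i) * (w j * f j)) = (\<Sum>i\<in>I. w i * f i)^2" for f :: "'a \<Rightarrow> real"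
    by (simp add: power2_eq_square sum_product)
  have "0 \<le> (\<Sum>i\<in>I. \<Sum>j\<in>I. w i * w j * (M i j - l * (x i * x j) - t * (z i * z j))^2)"
    using w_pos by (intro sum_nonneg mult_nonneg_nonneg) (auto simp: less_imp_le)
  also have "\<dots> = (\<Sum>i\<in>I. \<Sum>j\<in>I. w i * w j * M i j
      - 2 * l * (w i * w j * M i j * (x i * x j)) - 2 * t * (w i * w j * M i j * (z i * z j))
      + l^2 * ((w i * (x i)^2) * (w j * (x j)^2)) + t^2 * ((w i * (z i)^2) * (w j * (z j)^2))
      + 2 * l * t * ((w i * (x i * z i)) * (w j * (x j * z j))))"
  proof (intro sum.cong refl)
    fix i j
    have "w i * w j * (M i j - l * (x i * x j) - t * (z i * z j))^2 = w i * w j * (M i j)^2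
      - 2 * l * (w i * w j * M i j * (x i * x j)) - 2 * t * (w i * w j * M i j * (z i * z j))
      + l^2 * ((w i * (x i)^2) * (w j * (x j)^2)) + t^2 * ((w i * (z i)^2) * (w j * (z j)^2))
      + 2 * l * t * ((w i * (x i * z i)) * (w j * (x j * z j)))"
      by (simp add: power2_eq_square algebra_simps)
    then show "w i * w j * (M i j - l * (x i * x j) - t * (z i * z j))^2 = w i * w j * M i j
      - 2 * l * (w i * w j * M i j * (x i * x j)) - 2 * t * (w i * w j * M i j * (z i * z j))
      + l^2 * ((w i * (x i)^2) * (w j * (x j)^2)) + t^2 * ((w i * (z i)^2) * (w j * (z j)^2))
      + 2 * l * t * ((w i * (x i * z i)) * (w j * (x j * z j)))" by (simp add: MM)
  qed
  also have "\<dots> = (\<Sum>i\<in>I. \<Sum>j\<in>I. w i * w j * M i j)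
      - 2 * l * (\<Sum>i\<in>I. \<Sum>j\<in>I. w i * w j * M i j * (x i * x j))
      - 2 * t * (\<Sum>i\<in>I. \<Sum>j\<in>I. w i * w j * M i j * (z i * z j))
      + l^2 * (\<Sum>i\<in>I. \<Sum>j\<in>I. (w i * (x i)^2) * (w j * (x j)^2))
      + t^2 * (\<Sum>i\<in>I. \<Sum>j\<in>I. (w i * (z i)^2) * (w j * (z j)^2))
      + 2 * l * t * (\<Sum>i\<in>I. \<Sum>j\<in>I. (w i * (x i * z i)) * (w j * (x j * z j)))"
    by (simp only: sum.distrib sum_subtractf sum_distrib_left)
  also have "\<dots> = (\<Sum>i\<in>I. \<Sum>j\<in>I. w i * w j * M i j) - 2 * l * l - 2 * t * t + l^2 + t^2"
    unfolding a2 a3 prod sum_xx sum_zz sum_xz by simp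
  finally show ?thesis unfolding a1 by (simp add: power2_eq_square)
qed

lemma sum_nonadj_nonneg: "0 \<le> (\<Sum>i\<in>I. \<Sum>j\<in>nonadj i. w i * w j)"
  using w_pos by (intro sum_nonneg) (auto simp: nonadj_def less_imp_le)

lemma t_pos: "1/7 < t" and l_le_1: "l \<le> 1"
proof -
  have "l^2 \<le> 1" using frobenius sum_nonadj_nonneg zero_le_power2[of t] by linarith
  then show "l \<le> 1" using power2_le_imp_le[of l 1] by simp
  then show "1/7 < t" using large by linarith
qed

text \<open>The eigenvalue equation in terms of the nonneighbours: a vertex falls short of the
  universal value \<open>x\<^sub>B\<close> exactly by what it loses through them.\<close>

lemma deficit_x: "i \<in> I \<Longrightarrow> l * (x\<^sub>B - x i) = (\<Sum>j\<in>nonadj i. w j * x j)"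
  using eigen_x[of i] sum_adjacent_eq[of i "\<lambda>j. w j * x j"] l_pos
  by (simp add: x\<^sub>B_def algebra_simps)

lemma deficit_z: "i \<in> I \<Longrightarrow> t * (\<delta> - z i) = (\<Sum>j\<in>nonadj i. w j * z j)"
  using eigen_z[of i] sum_adjacent_eq[of i "\<lambda>j. w j * z j"] t_pos
  by (simp add: \<delta>_def algebra_simps)

lemma delta_nonneg: "0 \<le> \<delta>"
  using sum_z_nonneg t_pos by (simp add: \<delta>_def)

lemma finite_nonadj: "finite (nonadj i)"
  using finite_I by (simp add: nonadj_def)

lemma nonadj_opposite:
  assumes "i \<in> I" "j \<in> nonadj i" shows "z i * z j < 0"
proof -
  have "0 \<le> x i * x j" using assms x_nonneg by (simp add: nonadj_def)
  then show ?thesis using assms(2) by (simp add: nonadj_def)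
qed

text \<open>A vertex with positive \<open>z\<close> has only nonneighbours with negative \<open>z\<close>, and losing these
  pushes its \<open>z\<close> above \<open>\<delta>\<close>.\<close>

lemma P_iff: assumes "i \<in> I" shows "i \<in> P \<longleftrightarrow> 0 < z i \<and> nonadj i \<noteq> {}"
proof
  assume iP: "i \<in> P"
  then have zi: "\<delta> < z i" by (simp add: P_def)
  then have "t * (\<delta> - z i) < 0" using t_pos by (simp add: mult_less_0_iff)
  then show "0 < z i \<and> nonadj i \<noteq> {}" using deficit_z[OF assms] zi delta_nonneg by auto
next
  assume *: "0 < z i \<and> nonadj i \<noteq> {}"
  have "0 < - (w j * z j)" if "j \<in> nonadj i" for j
    using nonadj_opposite[OF assms that] * w_pos[of j] that
    by (auto simp: nonadj_def mult_less_0_iff)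
  then have "0 < (\<Sum>j\<in>nonadj i. - (w j * z j))"
    using * finite_nonadj by (intro sum_pos) auto
  then have "(\<Sum>j\<in>nonadj i. w j * z j) < 0" by (simp add: sum_negf)
  then have "t * (\<delta> - z i) < 0" using deficit_z[OF assms] by simp
  then show "i \<in> P" using t_pos assms by (simp add: P_def mult_less_0_iff)
qed

lemma Q_iff: assumes "i \<in> I" shows "i \<in> Q \<longleftrightarrow> z i < 0 \<and> nonadj i \<noteq> {}"
proof
  assume "i \<in> Q"
  then have zi: "z i < 0" by (simp add: Q_def)
  then have "0 < t * (\<delta> - z i)" using t_pos delta_nonneg by (simp add: zero_less_mult_iff)
  then show "z i < 0 \<and> nonadj i \<noteq> {}" using deficit_z[OF assms] zi by auto
qed (use assms in \<open>auto simp: Q_def\<close>)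

text \<open>All vertices outside \<open>P\<close> and \<open>Q\<close> are adjacent to everything, and so sit at one
  point. They form the class \<open>B\<close>.\<close>

lemma neutral:
  assumes "i \<in> I" "i \<notin> P" "i \<notin> Q"
  shows "nonadj i = {}" "z i = \<delta>" "x i = x\<^sub>B"
proof -
  have "0 \<le> z i" using assms by (auto simp: Q_def)
  then have "z i * z j < 0 \<Longrightarrow> 0 < z i" for j by (auto simp: mult_less_0_iff)
  then show e: "nonadj i = {}"
    using assms P_iff[OF assms(1)] nonadj_opposite[OF assms(1)] by blast
  show "z i = \<delta>" using deficit_z[OF assms(1)] e t_pos by simp
  show "x i = x\<^sub>B" using deficit_x[OF assms(1)] e l_pos by simp
qed

lemma P_subset: "P \<subseteq> I" and Q_subset: "Q \<subseteq> I" and finite_P: "finite P" and finite_Q: "finite Q"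
  and PQ_disjoint: "P \<inter> Q = {}"
  using finite_I delta_nonneg by (auto simp: P_def Q_def)

lemma nonadj_P: assumes "i \<in> P" shows "nonadj i = {j \<in> Q. x i * x j + z i * z j < 0}"
proof -
  have iI: "i \<in> I" using assms P_subset by auto
  have "0 < z i" using P_iff[OF iI] assms by auto
  then have "j \<in> Q" if "j \<in> nonadj i" for j
    using nonadj_opposite[OF iI that] that by (auto simp: Q_def nonadj_def mult_less_0_iff)
  then show ?thesis using Q_subset by (auto simp: nonadj_def)
qed

lemma nonadj_Q: assumes "i \<in> Q" shows "nonadj i = {j \<in> P. x j * x i + z j * z i < 0}"
proof -
  have iI: "i \<in> I" using assms Q_subset by auto
  have "z i < 0" using assms by (auto simp: Q_def)
  have "j \<in> P" if "j \<in> nonadj i" for j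
  proof -
    have jI: "j \<in> I" using that by (auto simp: nonadj_def)
    have "0 < z j" using nonadj_opposite[OF iI that] \<open>z i < 0\<close> by (auto simp: mult_less_0_iff)
    moreover have "i \<in> nonadj j" using that nonadj_sym[OF iI] by blast
    ultimately show ?thesis using P_iff[OF jI] by auto
  qed
  then show ?thesis using P_subset by (auto simp: nonadj_def mult.commute)
qed

lemma sum_I_split:
  "(\<Sum>i\<in>I. w i * f i) = (\<Sum>i\<in>P. w i * f i) + (\<Sum>i\<in>Q. w i * f i) + c * (1 - sum w P - sum w Q)"
  if "\<And>i. i \<in> I \<Longrightarrow> i \<notin> P \<Longrightarrow> i \<notin> Q \<Longrightarrow> f i = c" for f :: "'a \<Rightarrow> real"
proof -
  have split: "(\<Sum>i\<in>I. g i) = (\<Sum>i\<in>P. g i) + (\<Sum>i\<in>Q. g i) + (\<Sum>i\<in>I - P - Q. g i)" for g :: "'a \<Rightarrow> real"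
    using P_subset Q_subset PQ_disjoint finite_I
  proof -
    have "Q \<subseteq> I - P" using Q_subset PQ_disjoint by blast
    then show ?thesis
      using sum.subset_diff[OF P_subset finite_I, of g] sum.subset_diff[of Q "I - P" g] finite_I by simp
  qed
  have "(\<Sum>i\<in>I - P - Q. w i * f i) = c * sum w (I - P - Q)"
    using that by (simp add: sum_distrib_left mult.commute)
  then show ?thesis using split[of "\<lambda>i. w i * f i"] split[of w] sum_w by simp
qed

text \<open>In a complete graph all vertices would sit at one point, and \<open>x\<close> and \<open>z\<close> could not be
  orthogonal.\<close>

lemma exists_nonadj: "\<exists>i\<in>I. nonadj i \<noteq> {}"
proof (rule ccontr)
  assume "\<not> ?thesis"
  then have e: "nonadj i = {}" if "i \<in> I" for i using that by auto
  have zi: "z i = \<delta>" and xi: "x i = x\<^sub>B" if "i \<in> I" for i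
    using deficit_z[OF that] deficit_x[OF that] e[OF that] t_pos l_pos by auto
  have "(\<Sum>i\<in>I. w i * (x i)^2) = x\<^sub>B^2" "(\<Sum>i\<in>I. w i * (z i)^2) = \<delta>^2"
    "(\<Sum>i\<in>I. w i * (x i * z i)) = x\<^sub>B * \<delta>"
    using zi xi sum_w by (simp_all flip: sum_distrib_right)
  then show False using sum_xx sum_zz sum_xz by auto
qed

section \<open>Extreme vertices and their moments\<close>

lemma ellipse_antimono:
  assumes "i \<in> I" "j \<in> I" "\<bar>z i\<bar> \<le> \<bar>z j\<bar>" shows "x j \<le> x i"
proof -
  have "t * (z i)^2 \<le> t * (z j)^2"
    using assms(3) t_pos by (simp add: abs_le_square_iff)
  then have "l * (x j)^2 \<le> l * (x i)^2" using ellipse[OF assms(1)] ellipse[OF assms(2)] by linarith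
  then have "(x j)^2 \<le> (x i)^2" using l_pos by simp
  then show ?thesis using x_nonneg[OF assms(1)] by (rule power2_le_imp_le)
qed

text \<open>On the ellipse a larger \<open>\<bar>z\<bar>\<close> means a smaller \<open>x\<close>. Moving a vertex of \<open>P\<close> to the largest value of \<open>z\<close>
  therefore only decreases its inner products with points of \<open>Q\<close>, so the vertex with the largest \<open>z\<close> is
  nonadjacent to everything that is nonadjacent to some vertex of \<open>P\<close>, that is, to all of \<open>Q\<close>. The same
  holds at the other end. The deficits of these two vertices then are the first moments of \<open>Q\<close> and \<open>P\<close>.\<close>

lemma extreme_vertices:
  obtains u v where "u \<in> P" "v \<in> Q" "\<And>i. i \<in> I \<Longrightarrow> z i \<le> z u" "\<And>i. i \<in> I \<Longrightarrow> z v \<le> z i"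
    "nonadj u = Q" "nonadj v = P"
proof -
  obtain i j where ij: "i \<in> I" "j \<in> nonadj i" using exists_nonadj by auto
  then have jI: "j \<in> I" by (auto simp: nonadj_def)
  have "i \<in> nonadj j" using ij nonadj_sym by blast
  then have "i \<in> P \<or> i \<in> Q" "j \<in> P \<or> j \<in> Q"
    using ij jI neutral(1) by blast+
  then have ne: "P \<noteq> {}" "Q \<noteq> {}"
    using nonadj_P[of i] nonadj_Q[of i] ij by auto
  obtain u where u: "u \<in> P" "\<And>i. i \<in> P \<Longrightarrow> z i \<le> z u"
    using obtains_MAX[OF finite_P ne(1), of z] finite_P by (metis Max_ge finite_imageI imageI)
  obtain v where v: "v \<in> Q" "\<And>i. i \<in> Q \<Longrightarrow> z v \<le> z i"
    using obtains_MIN[OF finite_Q ne(2), of z] finite_Q by (metis Min_le finite_imageI imageI)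
  have uI: "u \<in> I" and vI: "v \<in> I" using u v P_subset Q_subset by auto
  have "z i \<le> z u" if "i \<in> I" for i
    using u that by (cases "i \<in> P") (force simp: P_def)+
  moreover have "z v \<le> z i" if "i \<in> I" for i
    using v that by (cases "i \<in> Q") (force simp: Q_def)+
  moreover have "nonadj u = Q"
  proof
    show "nonadj u \<subseteq> Q" using nonadj_P[OF u(1)] by auto
    show "Q \<subseteq> nonadj u"
    proof
      fix j assume j: "j \<in> Q"
      then obtain i where i: "i \<in> P" "x i * x j + z i * z j < 0"
        using Q_iff[of j] nonadj_Q[OF j] Q_subset by auto
      have iI: "i \<in> I" and jI: "j \<in> I" using i j P_subset Q_subset by auto
      have zi: "0 < z i" "z i \<le> z u" using P_iff[OF iI] i u by auto
      have "x u \<le> x i" using zi by (intro ellipse_antimono iI uI) auto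
      then have "x u * x j \<le> x i * x j" using x_nonneg[OF jI] by (rule mult_right_mono)
      moreover have "z u * z j \<le> z i * z j"
        using zi j by (intro mult_right_mono_neg) (auto simp: Q_def)
      ultimately show "j \<in> nonadj u" using i jI by (simp add: nonadj_def)
    qed
  qed
  moreover have "nonadj v = P"
  proof
    show "nonadj v \<subseteq> P" using nonadj_Q[OF v(1)] by auto
    show "P \<subseteq> nonadj v"
    proof
      fix j assume j: "j \<in> P"
      then obtain i where i: "i \<in> Q" "x i * x j + z i * z j < 0"
        using P_iff[of j] nonadj_P[OF j] P_subset by (auto simp: mult.commute)
      have iI: "i \<in> I" and jI: "j \<in> I" using i j P_subset Q_subset by auto
      have zi: "z i < 0" "z v \<le> z i" using i v by (auto simp: Q_def)
      have zj: "0 < z j" using P_iff[OF jI] j by auto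
      have "x v \<le> x i" using zi by (intro ellipse_antimono iI vI) auto
      then have "x v * x j \<le> x i * x j" using x_nonneg[OF jI] by (rule mult_right_mono)
      moreover have "z v * z j \<le> z i * z j" using zi zj by (intro mult_right_mono) auto
      ultimately show "j \<in> nonadj v" using i jI by (simp add: nonadj_def)
    qed
  qed
  ultimately show ?thesis using that u v by blast
qed

end

locale extreme_optimum = weighted_optimum +
  fixes u v :: 'a
  assumes u_P: "u \<in> P" and v_Q: "v \<in> Q"
    and z_le_u: "\<And>i. i \<in> I \<Longrightarrow> z i \<le> z u" and z_ge_v: "\<And>i. i \<in> I \<Longrightarrow> z v \<le> z i"
    and nonadj_u: "nonadj u = Q" and nonadj_v: "nonadj v = P"
begin

definition a where "a = z u"
definition c where "c = - z v"
definition p where "p = sum w P"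
definition q where "q = sum w Q"
definition b where "b = 1 - p - q"

lemma u_I: "u \<in> I" and v_I: "v \<in> I"
  using u_P v_Q P_subset Q_subset by auto

lemma a_gt: "\<delta> < a" and c_pos: "0 < c"
  using u_P v_Q by (auto simp: a_def c_def P_def Q_def)

lemma first_moments:
  shows zP: "(\<Sum>i\<in>P. w i * z i) = t * (c + \<delta>)" and zQ: "(\<Sum>i\<in>Q. w i * z i) = - t * (a - \<delta>)"
    and xP: "(\<Sum>i\<in>P. w i * x i) = l * (x\<^sub>B - x v)" and xQ: "(\<Sum>i\<in>Q. w i * x i) = l * (x\<^sub>B - x u)"
  using deficit_z[OF v_I] deficit_z[OF u_I] deficit_x[OF v_I] deficit_x[OF u_I]
  by (simp_all add: nonadj_u nonadj_v a_def c_def algebra_simps)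

lemma weights_nonneg: "0 \<le> p" "0 \<le> q" "0 \<le> b"
proof -
  show "0 \<le> p" "0 \<le> q"
    unfolding p_def q_def using w_pos P_subset Q_subset by (force intro!: sum_nonneg simp: less_imp_le)+
  have "p + q = sum w (P \<union> Q)"
    unfolding p_def q_def using finite_P finite_Q PQ_disjoint by (simp add: sum.union_disjoint)
  also have "\<dots> \<le> sum w I"
    using P_subset Q_subset finite_I w_pos by (intro sum_mono2) (auto simp: less_imp_le)
  finally show "0 \<le> b" using sum_w by (simp add: b_def)
qed

text \<open>The sum defining \<open>\<delta>\<close>, split over \<open>P\<close>, \<open>Q\<close> and \<open>B\<close>.\<close>

lemma balance_z: "t * (a - c - \<delta>) = b * \<delta>"
proof -
  have "t * \<delta> = (\<Sum>i\<in>I. w i * z i)" using t_pos by (simp add: \<delta>_def)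
  also have "\<dots> = t * (c + \<delta>) - t * (a - \<delta>) + \<delta> * b"
    using sum_I_split[of z \<delta>] neutral(2) by (simp add: zP zQ b_def p_def q_def)
  finally show ?thesis by (simp add: algebra_simps)
qed

lemma balance_x: "l * (x u + x v) = x\<^sub>B * (l + b)"
proof -
  have "l * x\<^sub>B = (\<Sum>i\<in>I. w i * x i)" using l_pos by (simp add: x\<^sub>B_def)
  also have "\<dots> = l * (x\<^sub>B - x v) + l * (x\<^sub>B - x u) + x\<^sub>B * b"
    using sum_I_split[of x x\<^sub>B] neutral(3) by (simp add: xP xQ b_def p_def q_def)
  finally show ?thesis by (simp add: algebra_simps)
qed

text \<open>The weight of the nonadjacent pairs, with (\<open>D\<close>) and without (\<open>Y\<close>) the factor \<open>\<bar>z i * z j\<bar>\<close>.\<close>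

definition D :: real where "D = (\<Sum>i\<in>P. \<Sum>j\<in>nonadj i. w i * w j * (z i * - z j))"
definition Y :: real where "Y = (\<Sum>i\<in>P. \<Sum>j\<in>nonadj i. w i * w j)"

lemma nonadj_swap:
  "(\<Sum>i\<in>P. \<Sum>j\<in>nonadj i. f i j) = (\<Sum>j\<in>Q. \<Sum>i\<in>nonadj j. f i j)" for f :: "'a \<Rightarrow> 'a \<Rightarrow> real"
  using sum.swap_restrict[OF finite_P finite_Q, of f "\<lambda>i j. x i * x j + z i * z j < 0"]
  by (simp add: nonadj_P nonadj_Q cong: sum.cong)

text \<open>Double counting: \<open>D\<close> evaluated row by row from \<open>P\<close> and from \<open>Q\<close> by means of \<open>deficit_z\<close>.
  This links the second moments of the two sides.\<close>

lemma cross_z: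
  shows D_P: "D = t * ((\<Sum>i\<in>P. w i * (z i)^2) - \<delta> * (t * (c + \<delta>)))"
    and D_Q: "D = t * ((\<Sum>i\<in>Q. w i * (z i)^2) + \<delta> * (t * (a - \<delta>)))"
proof -
  have "D = (\<Sum>i\<in>P. - w i * z i * (\<Sum>j\<in>nonadj i. w j * z j))"
    by (simp add: D_def sum_distrib_left sum_negf mult_ac)
  also have "\<dots> = (\<Sum>i\<in>P. t * (w i * (z i)^2 - \<delta> * (w i * z i)))"
    using P_subset by (intro sum.cong) (auto simp: algebra_simps power2_eq_square simp flip: deficit_z)
  also have "\<dots> = t * ((\<Sum>i\<in>P. w i * (z i)^2) - \<delta> * (t * (c + \<delta>)))"
    by (simp add: sum_subtractf zP flip: sum_distrib_left)
  finally show "D = t * ((\<Sum>i\<in>P. w i * (z i)^2) - \<delta> * (t * (c + \<delta>)))" .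
  have "D = (\<Sum>j\<in>Q. - w j * z j * (\<Sum>i\<in>nonadj j. w i * z i))"
    unfolding D_def nonadj_swap by (simp add: sum_distrib_left sum_negf mult_ac)
  also have "\<dots> = (\<Sum>i\<in>Q. t * (w i * (z i)^2 - \<delta> * (w i * z i)))"
    using Q_subset by (intro sum.cong) (auto simp: algebra_simps power2_eq_square simp flip: deficit_z)
  also have "\<dots> = t * ((\<Sum>i\<in>Q. w i * (z i)^2) + \<delta> * (t * (a - \<delta>)))"
    by (simp add: sum_subtractf zQ flip: sum_distrib_left)
  finally show "D = t * ((\<Sum>i\<in>Q. w i * (z i)^2) + \<delta> * (t * (a - \<delta>)))" .
qed

text \<open>The same double count with \<open>x\<close> in place of \<open>z\<close>.\<close>

lemma cross_x: "(\<Sum>i\<in>P. w i * (x i)^2) - (\<Sum>i\<in>Q. w i * (x i)^2) = x\<^sub>B * (l * (x u - x v))"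
proof -
  have "(\<Sum>i\<in>P. w i * x i * (\<Sum>j\<in>nonadj i. w j * x j)) = (\<Sum>j\<in>Q. w j * x j * (\<Sum>i\<in>nonadj j. w i * x i))"
    using nonadj_swap[of "\<lambda>i j. w i * x i * (w j * x j)"] by (simp add: sum_distrib_left mult_ac)
  moreover have R: "(\<Sum>i\<in>R. w i * x i * (\<Sum>j\<in>nonadj i. w j * x j))
      = l * (x\<^sub>B * (\<Sum>i\<in>R. w i * x i) - (\<Sum>i\<in>R. w i * (x i)^2))" if "R \<subseteq> I" for R
  proof -
    have "(\<Sum>i\<in>R. w i * x i * (\<Sum>j\<in>nonadj i. w j * x j)) = (\<Sum>i\<in>R. l * (x\<^sub>B * (w i * x i) - w i * (x i)^2))"
      using that by (intro sum.cong) (auto simp: algebra_simps power2_eq_square simp flip: deficit_x)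
    then show ?thesis by (simp add: sum_subtractf flip: sum_distrib_left)
  qed
  ultimately have "x\<^sub>B * (\<Sum>i\<in>P. w i * x i) - (\<Sum>i\<in>P. w i * (x i)^2)
      = x\<^sub>B * (\<Sum>i\<in>Q. w i * x i) - (\<Sum>i\<in>Q. w i * (x i)^2)"
    unfolding R[OF P_subset] R[OF Q_subset] using l_pos by simp
  then show ?thesis by (simp add: xP xQ algebra_simps)
qed

lemma second_moment_z:
  "(\<Sum>i\<in>P. w i * (z i)^2) + (\<Sum>i\<in>Q. w i * (z i)^2) + \<delta>^2 * b = 1"
  using sum_I_split[of "\<lambda>i. (z i)^2" "\<delta>^2"] neutral(2) sum_zz by (simp add: b_def p_def q_def)

lemma frobenius_Y: "l^2 + t^2 + 2 * Y \<le> 1"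
proof -
  have "(\<Sum>i\<in>I. \<Sum>j\<in>nonadj i. w i * w j) = (\<Sum>i\<in>I. w i * sum w (nonadj i))"
    by (simp add: sum_distrib_left)
  also have "\<dots> = (\<Sum>i\<in>P. w i * sum w (nonadj i)) + (\<Sum>i\<in>Q. w i * sum w (nonadj i))"
    using sum_I_split[of "\<lambda>i. sum w (nonadj i)" 0] neutral(1) by simp
  also have "\<dots> = 2 * Y"
    using nonadj_swap[of "\<lambda>i j. w i * w j"] by (simp add: Y_def sum_distrib_left mult.commute)
  finally show ?thesis using frobenius by simp
qed

definition T :: real where "T = (1 - t * \<delta>^2) / 2"

text \<open>The two evaluations of \<open>D\<close> and the normalisation of \<open>z\<close> are three linear equations
  for \<open>D\<close> and the second moments of \<open>P\<close> and \<open>Q\<close>.\<close>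

lemma
  shows D_eq: "D = t * T"
    and zzP: "(\<Sum>i\<in>P. w i * (z i)^2) = T + \<delta> * (t * (c + \<delta>))"
    and zzQ: "(\<Sum>i\<in>Q. w i * (z i)^2) = T - \<delta> * (t * (a - \<delta>))"
proof -
  define Z1 where "Z1 = (\<Sum>i\<in>P. w i * (z i)^2)"
  define Z2 where "Z2 = (\<Sum>i\<in>Q. w i * (z i)^2)"
  have 1: "Z1 - \<delta> * (t * (c + \<delta>)) = Z2 + \<delta> * (t * (a - \<delta>))"
    using D_P D_Q t_pos by (simp add: Z1_def Z2_def)
  have 2: "Z1 + Z2 + \<delta>^2 * b = 1" using second_moment_z by (simp add: Z1_def Z2_def)
  have 3: "\<delta> * (t * (c + \<delta>)) - \<delta> * (t * (a - \<delta>)) = t * \<delta>^2 - \<delta>^2 * b"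
    using arg_cong[OF balance_z, of "\<lambda>y. \<delta> * y"] by (simp add: algebra_simps power2_eq_square)
  have "2 * Z1 = 1 - t * \<delta>^2 + 2 * (\<delta> * (t * (c + \<delta>)))"
    "2 * Z2 = 1 - t * \<delta>^2 - 2 * (\<delta> * (t * (a - \<delta>)))"
    using 1 2 3 by simp_all
  then have solve: "Z1 = (1 - t * \<delta>^2) / 2 + \<delta> * (t * (c + \<delta>))"
    "Z2 = (1 - t * \<delta>^2) / 2 - \<delta> * (t * (a - \<delta>))"
    by (simp_all add: field_simps)
  show P: "(\<Sum>i\<in>P. w i * (z i)^2) = T + \<delta> * (t * (c + \<delta>))"
    and "(\<Sum>i\<in>Q. w i * (z i)^2) = T - \<delta> * (t * (a - \<delta>))"
    using solve by (simp_all add: Z1_def Z2_def T_def)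
  show "D = t * T" unfolding D_P P by simp
qed

lemma T_pos: "0 < T"
proof -
  have "0 < (\<Sum>i\<in>Q. w i * (z i)^2)"
    using v_Q finite_Q Q_subset w_pos by (intro sum_pos) (auto simp: Q_def)
  moreover have "0 \<le> \<delta> * (t * (a - \<delta>))" using delta_nonneg t_pos a_gt by simp
  ultimately show ?thesis unfolding zzQ by linarith
qed

text \<open>On \<open>P\<close> one has \<open>z \<le> a\<close>, so the second moment is at most \<open>a\<close> times the first.\<close>

lemma T_le: "T \<le> t * ((a - \<delta>) * (c + \<delta>))"
proof -
  have "(\<Sum>i\<in>P. w i * (z i)^2) \<le> (\<Sum>i\<in>P. a * (w i * z i))"
  proof (intro sum_mono)
    fix i assume "i \<in> P"
    then have i: "i \<in> I" "0 < z i" using P_subset P_iff by auto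
    have "w i * z i * z i \<le> w i * z i * a"
      using i z_le_u[of i] w_pos[of i] by (intro mult_left_mono) (auto simp: a_def)
    then show "w i * (z i)^2 \<le> a * (w i * z i)" by (simp add: power2_eq_square mult_ac)
  qed
  also have "\<dots> = a * (t * (c + \<delta>))" by (simp add: zP flip: sum_distrib_left)
  finally show ?thesis by (simp add: zzP algebra_simps)
qed

lemma Y_nonneg: "0 \<le> Y" and Y_le: "Y \<le> p * q"
proof -
  have pw: "0 \<le> w i" if "i \<in> P \<or> i \<in> Q" for i
    using that P_subset Q_subset w_pos by (auto simp: less_imp_le)
  show "0 \<le> Y"
    unfolding Y_def using pw nonadj_P by (intro sum_nonneg mult_nonneg_nonneg) auto
  have "Y \<le> (\<Sum>i\<in>P. \<Sum>j\<in>Q. w i * w j)"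
    unfolding Y_def using pw nonadj_P finite_Q by (intro sum_mono sum_mono2) auto
  then show "Y \<le> p * q" by (simp add: p_def q_def sum_product)
qed

text \<open>The Cauchy--Schwarz inequality for \<open>z i * z j\<close> over the nonadjacent pairs; these pairs
  are then enlarged to the product of \<open>P\<close> and \<open>Q\<close>, where the sum factorises.\<close>

lemma cross_cauchy: "D^2 \<le> Y * ((\<Sum>i\<in>P. w i * (z i)^2) * (\<Sum>i\<in>Q. w i * (z i)^2))"
proof -
  define E where "E = (\<Sum>i\<in>P. \<Sum>j\<in>nonadj i. w i * w j * (z i * - z j)^2)"
  have pw: "0 \<le> w i" if "i \<in> P \<or> i \<in> Q" for i
    using that P_subset Q_subset w_pos by (auto simp: less_imp_le)
  \<comment> \<open>\<open>D / Y\<close> is the weighted mean of \<open>z i * - z j\<close> over the nonadjacent pairs.\<close>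
  have "0 \<le> (\<Sum>i\<in>P. \<Sum>j\<in>nonadj i. w i * w j * (Y * (z i * - z j) - D)^2)"
    using pw nonadj_P by (intro sum_nonneg mult_nonneg_nonneg) auto
  also have "\<dots> = (\<Sum>i\<in>P. \<Sum>j\<in>nonadj i. Y^2 * (w i * w j * (z i * - z j)^2)
      - 2 * Y * D * (w i * w j * (z i * - z j)) + D^2 * (w i * w j))"
    by (intro sum.cong refl) (simp add: power2_eq_square algebra_simps)
  also have "\<dots> = Y^2 * E - 2 * Y * D * D + D^2 * Y"
    by (simp only: E_def D_def Y_def sum.distrib sum_subtractf sum_distrib_left)
  finally have "0 \<le> Y * (Y * E - D^2)" by (simp add: algebra_simps power2_eq_square)
  moreover have "0 < Y"
  proof -
    have "0 < w u * w v" using w_pos u_I v_I by simp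
    also have "\<dots> \<le> (\<Sum>j\<in>nonadj u. w u * w j)"
      using v_Q finite_Q pw u_P nonadj_u by (intro member_le_sum) auto
    also have "\<dots> \<le> Y" unfolding Y_def
      using u_P finite_P pw nonadj_P
      by (intro member_le_sum[of u P "\<lambda>i. \<Sum>j\<in>nonadj i. w i * w j"]) (auto intro!: sum_nonneg)
    finally show ?thesis .
  qed
  ultimately have "D^2 \<le> Y * E" by (simp add: zero_le_mult_iff)
  also have "E \<le> (\<Sum>i\<in>P. \<Sum>j\<in>Q. w i * w j * (z i * - z j)^2)"
    unfolding E_def using pw nonadj_P finite_Q by (intro sum_mono sum_mono2) auto
  also have "\<dots> = (\<Sum>i\<in>P. w i * (z i)^2) * (\<Sum>i\<in>Q. w i * (z i)^2)"
    unfolding sum_product by (intro sum.cong refl) (simp add: power_mult_distrib)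
  finally show ?thesis using Y_nonneg by (simp add: mult_left_mono)
qed

text \<open>\<open>cross_cauchy\<close> with all second moments expressed through \<open>T\<close>. It says that enough pairs must be
  nonadjacent for \<open>t\<close> to be an eigenvalue; against it stands \<open>frobenius_gap\<close>, which says that few
  nonadjacent pairs are allowed if \<open>l + t\<close> exceeds \<open>8/7\<close>. Together they confine \<open>t\<close>, \<open>b\<close> and \<open>\<delta>\<close> to the
  range in which \<open>tent_gap_inequality\<close> applies.\<close>

lemma Y_lower: "t^2 * T \<le> Y * (T - \<delta>^2 * b)"
proof -
  define \<alpha> where "\<alpha> = a - \<delta>"
  define \<beta> where "\<beta> = c + \<delta>"
  have ba: "t * (\<beta> - \<alpha>) = \<delta> * (t - b)"
    using balance_z by (simp add: \<alpha>_def \<beta>_def algebra_simps)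
  have "(T + \<delta> * (t * \<beta>)) * (T - \<delta> * (t * \<alpha>)) = T^2 + T * \<delta> * (t * (\<beta> - \<alpha>)) - \<delta>^2 * t * (t * (\<alpha> * \<beta>))"
    by Groebner_Basis.algebra
  also have "\<dots> \<le> T^2 + T * \<delta> * (t * (\<beta> - \<alpha>)) - \<delta>^2 * t * T"
    using T_le t_pos by (intro diff_left_mono mult_left_mono) (auto simp: \<alpha>_def \<beta>_def)
  also have "\<dots> = T * (T - \<delta>^2 * b)"
    unfolding ba by Groebner_Basis.algebra
  finally have "(T + \<delta> * (t * \<beta>)) * (T - \<delta> * (t * \<alpha>)) \<le> T * (T - \<delta>^2 * b)" .
  then have "Y * ((T + \<delta> * (t * \<beta>)) * (T - \<delta> * (t * \<alpha>))) \<le> Y * (T * (T - \<delta>^2 * b))"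
    using Y_nonneg by (rule mult_left_mono)
  moreover have "(t * T)^2 \<le> Y * ((T + \<delta> * (t * \<beta>)) * (T - \<delta> * (t * \<alpha>)))"
    using cross_cauchy unfolding D_eq zzP zzQ \<alpha>_def \<beta>_def .
  ultimately have "T * (t^2 * T) \<le> T * (Y * (T - \<delta>^2 * b))"
    by (simp add: power2_eq_square mult_ac)
  then show ?thesis using T_pos by (rule mult_left_le_imp_le)
qed

lemma t_sq_le_Y: "t^2 \<le> Y"
proof -
  have "t^2 * T \<le> Y * (T - \<delta>^2 * b)" by (rule Y_lower)
  also have "\<dots> \<le> Y * T" using Y_nonneg weights_nonneg by (intro mult_left_mono) auto
  finally show ?thesis using T_pos by (rule mult_right_le_imp_le)
qed

text \<open>With \<open>l\<close> replaced by \<open>8/7 - t\<close>, the inequality \<open>l^2 + t^2 + 2 * Y \<le> 1\<close> bounds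
  \<open>2 * (Y - t^2)\<close> by a quadratic in \<open>t\<close> with roots \<open>3/14\<close> and \<open>5/14\<close>.\<close>

lemma frobenius_gap: "2 * (Y - t^2) < (2 * t - 3/7) * (5/7 - 2 * t)"
proof -
  have "8/7 - t < l" "0 \<le> 8/7 - t" using large t_le_l l_le_1 by linarith+
  then have "(8/7 - t)^2 < l^2" by (intro power_strict_mono) auto
  then show ?thesis using frobenius_Y by (simp add: power2_eq_square algebra_simps)
qed

lemma t_bounds: "3/14 < t" "t < 5/14"
proof -
  have "0 \<le> 2 * (Y - t^2)" using t_sq_le_Y by simp
  then have "0 < (2 * t - 3/7) * (5/7 - 2 * t)" using frobenius_gap by (rule le_less_trans)
  then show "3/14 < t" "t < 5/14" unfolding zero_less_mult_iff by linarith+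
qed

text \<open>From \<open>t^2 \<le> Y \<le> p * q\<close> by the inequality of the means.\<close>

lemma b_le: "b \<le> 1 - 2 * t"
proof -
  have "(2 * t)^2 \<le> 4 * (p * q)" using t_sq_le_Y Y_le by (simp add: power_mult_distrib)
  also have "\<dots> \<le> (p + q)^2"
    using zero_le_power2[of "p - q"] by (simp add: power2_eq_square algebra_simps)
  finally have "2 * t \<le> p + q" using weights_nonneg by (intro power2_le_imp_le[of "2 * t"]) auto
  then show ?thesis by (simp add: b_def)
qed

lemma delta_b_le:
  "4 * t * (t * \<delta>^2) * b \<le> (1 - t * \<delta>^2) * ((2 * t - 3/7) * (5/7 - 2 * t))"
proof -
  have "t^2 * (\<delta>^2 * b) \<le> Y * (\<delta>^2 * b)"
    using t_sq_le_Y weights_nonneg by (intro mult_right_mono) auto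
  also have "\<dots> \<le> T * (Y - t^2)" using Y_lower by (simp add: algebra_simps)
  finally have "4 * t * (t * \<delta>^2) * b \<le> 2 * T * (2 * (Y - t^2))"
    by (simp add: power2_eq_square algebra_simps)
  also have "\<dots> \<le> 2 * T * ((2 * t - 3/7) * (5/7 - 2 * t))"
    using frobenius_gap T_pos by (intro mult_left_mono) auto
  also have "2 * T = 1 - t * \<delta>^2" by (simp add: T_def)
  finally show ?thesis .
qed

text \<open>Summing the equation of the ellipse over \<open>P\<close> and over \<open>Q\<close> expresses \<open>p\<close> and \<open>q\<close> through second moments,
  whose differences are known from \<open>cross_x\<close> and \<open>cross_z\<close>. The remaining factor \<open>x v - x u\<close> comes from
  the equation of the ellipse at \<open>u\<close> and \<open>v\<close>, divided by \<open>balance_x\<close>.\<close>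

lemma weight_gap:
  "q - p = \<delta> * (a + c) * ((l - t) * (l * t / (l + t) + b) / (l + b))"
proof -
  have lb: "0 < l + b" using l_pos weights_nonneg by linarith
  have ac: "t * (a - c) = \<delta> * (t + b)" using balance_z by (simp add: algebra_simps)
  have mass: "(l + t) * sum w R = l * (\<Sum>i\<in>R. w i * (x i)^2) + t * (\<Sum>i\<in>R. w i * (z i)^2)"
    if "R \<subseteq> I" for R
  proof -
    have "(l + t) * sum w R = (\<Sum>i\<in>R. w i * (l * (x i)^2 + t * (z i)^2))"
      using that ellipse by (simp add: sum_distrib_left mult.commute subset_eq)
    then show ?thesis by (simp add: sum.distrib sum_distrib_left algebra_simps)
  qed
  have zz: "(\<Sum>i\<in>P. w i * (z i)^2) - (\<Sum>i\<in>Q. w i * (z i)^2) = \<delta> * t * (a + c)"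
    by (simp add: zzP zzQ algebra_simps)
  have diff: "(l + t) * (q - p) = l^2 * (x\<^sub>B * (x v - x u)) - t^2 * \<delta> * (a + c)"
    using mass[OF P_subset] mass[OF Q_subset]
      arg_cong[OF cross_x, of "\<lambda>y. l * y"] arg_cong[OF zz, of "\<lambda>y. t * y"]
    by (simp add: p_def q_def algebra_simps power2_eq_square)
  have "l * ((x v)^2 - (x u)^2) = t * (a^2 - c^2)"
    using ellipse[OF u_I] ellipse[OF v_I] by (simp add: a_def c_def algebra_simps)
  then have "(x v - x u) * (l * (x u + x v)) = (t * (a - c)) * (a + c)"
    by (simp add: power2_eq_square algebra_simps)
  then have "(x v - x u) * (x\<^sub>B * (l + b)) = \<delta> * (t + b) * (a + c)"
    unfolding balance_x ac .
  then have "x\<^sub>B * (x v - x u) = \<delta> * (a + c) * (t + b) / (l + b)"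
    using lb by (simp add: field_simps)
  then have "(l + t) * (q - p) = \<delta> * (a + c) * (l^2 * (t + b) / (l + b) - t^2)"
    unfolding diff by (simp add: algebra_simps)
  also have "l^2 * (t + b) / (l + b) - t^2 = (l + t) * ((l - t) * (l * t / (l + t) + b) / (l + b))"
  proof -
    have "l + t \<noteq> 0" using large by simp
    then have "(l + t) * (l * t / (l + t) + b) = l * t + b * (l + t)" by (simp add: field_simps)
    then have "(l + t) * ((l - t) * (l * t / (l + t) + b) / (l + b)) = (l - t) * (l * t + b * (l + t)) / (l + b)"
      by (metis mult.left_commute times_divide_eq_right)
    also have "\<dots> = l^2 * (t + b) / (l + b) - t^2"
      using lb by (simp add: field_simps power2_eq_square)
    finally show ?thesis ..
  qed
  finally have "(l + t) * (q - p) = (l + t) * (\<delta> * (a + c) * ((l - t) * (l * t / (l + t) + b) / (l + b)))"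
    by (simp only: mult.left_commute)
  then show ?thesis using large by (simp only: mult_cancel_left) auto
qed

text \<open>The quantity is the first moment of the distance from the extreme value, \<open>\<Sum>i\<in>Q. w i * (z i + c)\<close>,
  minus its counterpart \<open>\<Sum>i\<in>P. w i * (a - z i)\<close>: the side with the smaller extreme value is the more
  spread one. By \<open>weight_gap\<close> it equals \<open>\<delta> / t\<close> times the difference of \<open>X * g\<close> and a polynomial in \<open>t\<close>
  and \<open>b\<close>, and \<open>T_le\<close> bounds \<open>X\<close> from below, so that \<open>tent_gap_inequality\<close> finishes.\<close>

lemma spread_gap: "0 \<le> c * q - a * p + \<delta> * (t - b)"
proof -
  define g where "g = (l - t) * (l * t / (l + t) + b) / (l + b)"
  define X where "X = t * (a + c)^2 / 2"
  have qp: "q - p = \<delta> * (a + c) * g" using weight_gap by (simp add: g_def)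
  have ac: "t * (a - c) = \<delta> * (t + b)" using balance_z by (simp add: algebra_simps)
  have X: "1 - t * \<delta>^2 + t * \<delta>^2 * (b / t - 1)^2 / 2 \<le> X"
  proof -
    have split_half: "t * (4 * y + d * k) / 2 = 2 * (t * y) + t * d * k / 2" for y d k
      by (simp add: field_simps)
    have "(a - \<delta>) - (c + \<delta>) = \<delta> * (b / t - 1)"
      using ac t_pos by (simp add: field_simps)
    then have "(a + c)^2 = 4 * ((a - \<delta>) * (c + \<delta>)) + \<delta>^2 * (b / t - 1)^2"
      unfolding power_mult_distrib[symmetric] by (metis square_sum_diff)
    then have "X = 2 * (t * ((a - \<delta>) * (c + \<delta>))) + t * \<delta>^2 * (b / t - 1)^2 / 2"
      unfolding X_def using split_half[of "(a - \<delta>) * (c + \<delta>)" "\<delta>^2" "(b / t - 1)^2"] by simp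
    then show ?thesis using T_le by (simp add: T_def)
  qed
  have "(t + b) * (1 - b) / 2 - t * (t - b) \<le> X * g"
    unfolding g_def
    by (rule tent_gap_inequality[OF t_bounds weights_nonneg(3) b_le, where e = "t * \<delta>^2"])
      (use t_pos T_pos large delta_b_le X in \<open>auto simp: T_def\<close>)
  then have "0 \<le> \<delta> * (X * g - ((t + b) * (1 - b) / 2 - t * (t - b)))"
    using delta_nonneg by simp
  also have "\<dots> = t * (c * q - a * p + \<delta> * (t - b))"
  proof -
    have pq: "p = (1 - b - (q - p)) / 2" by (simp add: b_def)
    have "t * (c * q - a * p + \<delta> * (t - b)) = t * c * (q - p) - t * (a - c) * p + t * \<delta> * (t - b)"
      by (simp add: algebra_simps)
    also have "\<dots> = t * c * (q - p) - t * (a - c) * ((1 - b - (q - p)) / 2) + t * \<delta> * (t - b)"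
      using pq by simp
    also have "\<dots> = t * (c + (a - c) / 2) * (q - p) - t * (a - c) * (1 - b) / 2 + t * \<delta> * (t - b)"
      by (simp add: field_simps)
    also have "\<dots> = t * ((a + c) / 2) * (\<delta> * (a + c) * g) - \<delta> * (t + b) * (1 - b) / 2 + t * \<delta> * (t - b)"
      unfolding qp ac by (simp add: field_simps)
    also have "\<dots> = \<delta> * (X * g - ((t + b) * (1 - b) / 2 - t * (t - b)))"
      by (simp add: X_def field_simps power2_eq_square)
    finally show ?thesis ..
  qed
  finally show ?thesis using t_pos by (simp add: zero_le_mult_iff)
qed

section \<open>Comparison with a three-class model\<close>

lemma delta_le: "c + \<delta> \<le> a"
proof -
  have "0 \<le> t * (a - c - \<delta>)" unfolding balance_z using weights_nonneg delta_nonneg by simp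
  then show ?thesis using t_pos by (simp add: zero_le_mult_iff)
qed

lemma sum_wx_pos: "0 < (\<Sum>i\<in>I. w i * x i)"
proof -
  obtain k where k: "k \<in> I" "x k \<noteq> 0"
    using sum_xx by (force intro: ccontr)
  then have "0 < w k * x k" using w_pos x_nonneg by (simp add: order_less_le)
  then show ?thesis
    using k finite_I w_pos x_nonneg by (intro sum_pos2[of I k]) (auto simp: less_imp_le)
qed

text \<open>If \<open>\<phi>\<close> loses in each row at least \<open>l * (h - \<phi> i)\<close>, pair all rows with the nonnegative
  eigenfunction \<open>x\<close>; the terms in \<open>\<phi>\<close> cancel by \<open>deficit_x\<close> and the bound on the total remains.\<close>

lemma supersolution_bound:
  assumes row: "\<And>i. i \<in> I \<Longrightarrow> l * (h - \<phi> i) \<le> (\<Sum>j\<in>nonadj i. w j * \<phi> j)"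
  shows "l * h \<le> (\<Sum>i\<in>I. w i * \<phi> i)"
proof -
  define X where "X = (\<Sum>i\<in>I. w i * x i)"
  define \<Phi> where "\<Phi> = (\<Sum>i\<in>I. w i * \<phi> i)"
  define Z where "Z = (\<Sum>i\<in>I. w i * x i * \<phi> i)"
  have lxB: "l * x\<^sub>B = X" using l_pos by (simp add: x\<^sub>B_def X_def)
  have "l * h * X - l * Z = (\<Sum>i\<in>I. w i * x i * (l * (h - \<phi> i)))"
    by (simp add: X_def Z_def sum_distrib_left sum_subtractf algebra_simps)
  also have "\<dots> \<le> (\<Sum>i\<in>I. w i * x i * (\<Sum>j\<in>nonadj i. w j * \<phi> j))"
    using row w_pos x_nonneg by (intro sum_mono mult_left_mono) (auto simp: less_imp_le)
  also have "\<dots> = (\<Sum>j\<in>I. w j * \<phi> j * (\<Sum>i\<in>nonadj j. w i * x i))"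
    using sum.swap_restrict[OF finite_I finite_I, of "\<lambda>i j. w i * x i * (w j * \<phi> j)" "\<lambda>i j. x i * x j + z i * z j < 0"]
    by (simp add: nonadj_def sum_distrib_left mult_ac)
  also have "\<dots> = (\<Sum>j\<in>I. w j * \<phi> j * X - l * (w j * x j * \<phi> j))"
    by (intro sum.cong refl) (simp add: deficit_x[symmetric] right_diff_distrib lxB[symmetric] mult_ac)
  also have "\<dots> = \<Phi> * X - l * Z"
    by (simp add: \<Phi>_def Z_def sum_subtractf sum_distrib_left sum_distrib_right)
  finally have "l * h * X \<le> \<Phi> * X" by simp
  then show ?thesis using sum_wx_pos by (simp add: X_def \<Phi>_def)
qed

text \<open>Split the weight of each vertex of \<open>P\<close> between the values \<open>a\<close> (class \<open>A\<close>) and \<open>\<delta>\<close> (class \<open>B\<close>), and that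
  of each vertex of \<open>Q\<close> between \<open>- c\<close> (class \<open>C\<close>) and \<open>\<delta>\<close>, so that the total weight and the first moment of
  \<open>z\<close> are preserved. Then \<open>w\<^sub>A\<close> and \<open>w\<^sub>C\<close> are the resulting class weights, and \<open>B\<close> has the rest. In the
  three-class model a row in \<open>A\<close> loses weight \<open>c\<^sub>0\<close> from \<open>C\<close>, and a row in \<open>C\<close> loses weight \<open>a\<^sub>0\<close> from \<open>A\<close>;
  these numbers are such that the function with values \<open>a\<close>, \<open>- c\<close>, \<open>\<delta>\<close> is an eigenfunction of the model
  with eigenvalue exactly \<open>t\<close>.\<close>

definition \<alpha> where "\<alpha> = a - \<delta>"
definition \<beta> where "\<beta> = c + \<delta>"
definition a\<^sub>0 where "a\<^sub>0 = t * \<beta> / a"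
definition c\<^sub>0 where "c\<^sub>0 = t * \<alpha> / c"
definition w\<^sub>A where "w\<^sub>A = (t * \<beta> - \<delta> * p) / \<alpha>"
definition w\<^sub>C where "w\<^sub>C = (t * \<alpha> + \<delta> * q) / \<beta>"

lemma shape: "0 < \<alpha>" "\<alpha> \<le> a" "0 < a" "0 < \<beta>" "c \<le> \<beta>" "\<beta> \<le> a" "0 < c"
  using a_gt c_pos delta_nonneg delta_le by (auto simp: \<alpha>_def \<beta>_def)

lemma zP_le: "t * \<beta> \<le> a * p"
proof -
  have "(\<Sum>i\<in>P. w i * z i) \<le> (\<Sum>i\<in>P. w i * a)"
    using P_subset w_pos z_le_u by (intro sum_mono mult_left_mono) (auto simp: a_def less_imp_le)
  then show ?thesis by (simp add: zP \<beta>_def p_def sum_distrib_left mult.commute)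
qed

lemma zQ_le: "t * \<alpha> \<le> c * q"
proof -
  have "(\<Sum>i\<in>Q. w i * - z i) \<le> (\<Sum>i\<in>Q. w i * c)"
    using Q_subset w_pos z_ge_v by (intro sum_mono mult_left_mono) (auto simp: c_def less_imp_le)
  then show ?thesis by (simp add: zQ \<alpha>_def q_def sum_distrib_left mult.commute sum_negf)
qed

lemma block_bounds: "0 < a\<^sub>0" "a\<^sub>0 \<le> t" "0 < c\<^sub>0" "c\<^sub>0 \<le> 1"
proof -
  show "0 < a\<^sub>0" "0 < c\<^sub>0" using shape t_pos by (simp_all add: a\<^sub>0_def c\<^sub>0_def)
  show "a\<^sub>0 \<le> t" using shape t_pos by (simp add: a\<^sub>0_def divide_le_eq)
  have "q \<le> 1" using weights_nonneg by (simp add: b_def)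
  then have "c * q \<le> c" using shape by simp
  then have "t * \<alpha> \<le> c" using zQ_le by linarith
  then show "c\<^sub>0 \<le> 1" using shape by (simp add: c\<^sub>0_def)
qed

lemma l_gt: "11/14 < l"
  using large t_bounds by linarith

text \<open>The left-hand side is the characteristic polynomial of the three-class model at \<open>l\<close>. The numbers \<open>f\<close>,
  \<open>g\<close>, \<open>h\<close> are values on \<open>A\<close>, \<open>C\<close>, \<open>B\<close> that satisfy the two equations of the model for the rows in \<open>A\<close>
  and \<open>C\<close>. Interpolated linearly in \<open>z\<close> on either side of \<open>\<delta>\<close> they give a tent-shaped function \<open>\<phi>\<close>, whose
  total is the total in the model because splitting preserves first moments. Towards the extremes
  \<open>\<phi> / \<bar>z\<bar>\<close> is smallest, so a row with given \<open>z i\<close> loses at least what it would lose if its nonneighbours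
  were extreme, which is \<open>l * (h - \<phi> i)\<close>. Now \<open>supersolution_bound\<close> yields the third equation as an
  inequality.\<close>

lemma tent_bound:
  "l^3 - l^2 + l * (c\<^sub>0 * w\<^sub>A + a\<^sub>0 * w\<^sub>C - a\<^sub>0 * c\<^sub>0) + a\<^sub>0 * c\<^sub>0 * (1 - w\<^sub>A - w\<^sub>C) \<le> 0"
proof -
  define f where "f = l * (l - c\<^sub>0)"
  define g where "g = l * (l - a\<^sub>0)"
  define h where "h = l^2 - a\<^sub>0 * c\<^sub>0"
  define \<phi> where "\<phi> i = (if i \<in> P then h - (h - f) / \<alpha> * (z i - \<delta>)
    else if i \<in> Q then h - (h - g) / \<beta> * (\<delta> - z i) else h)" for i
  have hf: "h - f = c\<^sub>0 * (l - a\<^sub>0)" and hg: "h - g = a\<^sub>0 * (l - c\<^sub>0)"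
    by (auto simp: h_def f_def g_def power2_eq_square algebra_simps)
  have la: "0 \<le> l - a\<^sub>0" using block_bounds t_le_l by linarith
  have g0: "0 \<le> g" using la l_pos by (simp add: g_def)
  have hf0: "0 \<le> h - f" unfolding hf using la block_bounds by simp
  have h0: "0 \<le> h"
  proof -
    have "a\<^sub>0 * c\<^sub>0 \<le> t * 1" using block_bounds t_pos by (intro mult_mono) auto
    moreover have "(11/14)^2 \<le> l^2" using l_gt by (intro power_mono) auto
    ultimately show ?thesis using t_bounds by (simp add: h_def power2_eq_square)
  qed
  have \<phi>_Q: "g / c * - z j \<le> \<phi> j" if "j \<in> Q" for j
  proof -
    have zj: "0 \<le> z j + c" using z_ge_v[of j] that Q_subset by (auto simp: c_def)
    have "0 \<le> h / \<beta>" using h0 shape by simp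
    also have "\<dots> \<le> (h - g) / \<beta> + g / c"
      using shape g0 by (simp add: diff_divide_distrib frac_le)
    finally have "0 \<le> (z j + c) * ((h - g) / \<beta> + g / c)" using zj by simp
    also have "\<dots> = (h - (h - g) / \<beta> * (\<beta> - (z j + c))) - g / c * (c - (z j + c))"
      using shape by (simp add: right_diff_distrib) (simp add: algebra_simps)
    also have "\<dots> = \<phi> j - g / c * - z j"
      using that PQ_disjoint by (auto simp: \<phi>_def \<beta>_def)
    finally show ?thesis by simp
  qed
  have \<phi>_P: "f / a * z j \<le> \<phi> j" if "j \<in> P" for j
  proof -
    have zj: "0 \<le> a - z j" using z_le_u[of j] that P_subset by (auto simp: a_def)
    have "0 \<le> h / a" using h0 shape by simp
    also have "\<dots> = (h - f) / a + f / a" by (simp add: diff_divide_distrib)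
    also have "\<dots> \<le> (h - f) / \<alpha> + f / a"
      using shape hf0 by (simp add: frac_le)
    finally have "0 \<le> (a - z j) * ((h - f) / \<alpha> + f / a)" using zj by simp
    also have "\<dots> = \<phi> j - f / a * z j"
      using that shape by (auto simp: \<phi>_def \<alpha>_def field_simps)
    finally show ?thesis by simp
  qed
  have row: "l * (h - \<phi> i) \<le> (\<Sum>j\<in>nonadj i. w j * \<phi> j)" if i: "i \<in> I" for i
  proof -
    consider "i \<in> P" | "i \<in> Q" "i \<notin> P" | "i \<notin> P" "i \<notin> Q" by blast
    then show ?thesis
    proof cases
      case 1
      have "l * (h - \<phi> i) = g / c * (t * (z i - \<delta>))"
        using 1 shape by (simp add: \<phi>_def hf c\<^sub>0_def g_def field_simps)
      also have "\<dots> = (\<Sum>j\<in>nonadj i. g / c * (w j * - z j))"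
        using deficit_z[OF i] by (simp add: sum_negf algebra_simps flip: sum_distrib_left sum_divide_distrib)
      also have "\<dots> \<le> (\<Sum>j\<in>nonadj i. w j * \<phi> j)"
      proof (intro sum_mono)
        fix j assume "j \<in> nonadj i"
        then have j: "j \<in> Q" using nonadj_P[OF 1] by auto
        then show "g / c * (w j * - z j) \<le> w j * \<phi> j"
          using mult_left_mono[OF \<phi>_Q[OF j], of "w j"] w_pos[of j] Q_subset by (auto simp: mult_ac)
      qed
      finally show ?thesis .
    next
      case 2
      have "l * (h - \<phi> i) = f / a * (t * (\<delta> - z i))"
        using 2 shape by (simp add: \<phi>_def hg a\<^sub>0_def f_def field_simps)
      also have "\<dots> = (\<Sum>j\<in>nonadj i. f / a * (w j * z j))"
        unfolding deficit_z[OF i] by (simp add: sum_distrib_left)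
      also have "\<dots> \<le> (\<Sum>j\<in>nonadj i. w j * \<phi> j)"
      proof (intro sum_mono)
        fix j assume "j \<in> nonadj i"
        then have j: "j \<in> P" using nonadj_Q[OF 2(1)] by auto
        then show "f / a * (w j * z j) \<le> w j * \<phi> j"
          using mult_left_mono[OF \<phi>_P[OF j], of "w j"] w_pos[of j] P_subset by (auto simp: mult_ac)
      qed
      finally show ?thesis .
    next
      case 3
      then show ?thesis using neutral(1)[OF i] by (simp add: \<phi>_def)
    qed
  qed
  have lin: "w i * (h - k * (y - y')) = h * w i - k * (w i * y - y' * w i)"
    and lin': "w i * (h - k * (y' - y)) = h * w i - k * (y' * w i - w i * y)" for i k y y'
    by (simp_all add: algebra_simps)
  have "l * h \<le> (\<Sum>i\<in>I. w i * \<phi> i)" using row by (rule supersolution_bound)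
  also have "\<dots> = (\<Sum>i\<in>P. w i * \<phi> i) + (\<Sum>i\<in>Q. w i * \<phi> i) + h * b"
    using sum_I_split[of \<phi> h] by (simp add: \<phi>_def b_def p_def q_def)
  also have "(\<Sum>i\<in>P. w i * \<phi> i) = (\<Sum>i\<in>P. h * w i - (h - f) / \<alpha> * (w i * z i - \<delta> * w i))"
    by (intro sum.cong refl) (simp add: \<phi>_def lin del: times_divide_eq_left)
  also have "\<dots> = h * p - (h - f) * w\<^sub>A"
    unfolding sum_subtractf sum_distrib_left[symmetric] zP by (simp add: p_def w\<^sub>A_def \<beta>_def)
  also have "(\<Sum>i\<in>Q. w i * \<phi> i) = (\<Sum>i\<in>Q. h * w i - (h - g) / \<beta> * (\<delta> * w i - w i * z i))"
    using PQ_disjoint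
    by (intro sum.cong refl) (auto simp: \<phi>_def lin' simp del: times_divide_eq_left)
  also have "\<dots> = h * q - (h - g) * w\<^sub>C"
    unfolding sum_subtractf sum_distrib_left[symmetric] zQ by (simp add: q_def w\<^sub>C_def \<alpha>_def add.commute)
  also have "h * p - (h - f) * w\<^sub>A + (h * q - (h - g) * w\<^sub>C) + h * b = h - (h - f) * w\<^sub>A - (h - g) * w\<^sub>C"
    by (simp add: b_def algebra_simps)
  finally have "l * h - h + (h - f) * w\<^sub>A + (h - g) * w\<^sub>C \<le> 0" by simp
  then show ?thesis
    unfolding hf hg by (simp add: h_def power2_eq_square power3_eq_cube algebra_simps)
qed

text \<open>Let \<open>p(X) = X^3 - X^2 + e\<^sub>2 * X + K\<close> be the characteristic polynomial of the three-class model. It has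
  the root \<open>t\<close>, its roots add up to 1, and \<open>p(l) \<le> 0\<close> by \<open>tent_bound\<close>. If also \<open>p(- 1/7) \<le> 0\<close>, then
  writing \<open>p(X) = (X - t) * q(X)\<close> gives \<open>q(l) \<le> 0 \<le> q(- 1/7)\<close>, whereas
  \<open>q(l) - q(- 1/7) = (l + 1/7) * (l + t - 8/7)\<close> is positive. The value \<open>p(- 1/7) = K - e\<^sub>2 / 7 - 8/343\<close> is
  controlled by replacing \<open>w\<^sub>A\<close>, \<open>w\<^sub>C\<close> by \<open>a\<^sub>0\<close>, \<open>c\<^sub>0\<close>, which is legitimate by \<open>spread_gap\<close>; the inequality
  of the means for \<open>a\<^sub>0\<close>, \<open>c\<^sub>0\<close> and \<open>6/7 - a\<^sub>0 - c\<^sub>0\<close> then bounds their product by \<open>(2/7)^3\<close>.\<close>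

lemma no_large_extreme_optimum: False
proof -
  define e\<^sub>2 where "e\<^sub>2 = c\<^sub>0 * w\<^sub>A + a\<^sub>0 * w\<^sub>C - a\<^sub>0 * c\<^sub>0"
  define K where "K = a\<^sub>0 * c\<^sub>0 * (1 - w\<^sub>A - w\<^sub>C)"
  define A where "A = a * p - t * \<beta>"
  define C where "C = c * q - t * \<alpha>"
  have ba: "t * (\<beta> - \<alpha>) = \<delta> * (t - b)"
    using balance_z by (simp add: \<alpha>_def \<beta>_def algebra_simps)
  \<comment> \<open>\<open>A\<close> and \<open>C\<close> measure how far \<open>P\<close> and \<open>Q\<close> are from being concentrated at \<open>a\<close> and \<open>- c\<close>.\<close>
  have AC: "0 \<le> A" "A \<le> C"
    using zP_le spread_gap ba by (auto simp: A_def C_def algebra_simps)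
  have gA: "w\<^sub>A = a\<^sub>0 - \<delta> * A / (a * \<alpha>)"
  proof -
    have "a * \<alpha> * w\<^sub>A = a * \<alpha> * (a\<^sub>0 - \<delta> * A / (a * \<alpha>))"
      using shape by (simp add: w\<^sub>A_def a\<^sub>0_def A_def field_simps) (simp add: \<alpha>_def algebra_simps)
    then show ?thesis using shape by simp
  qed
  have gC: "w\<^sub>C = c\<^sub>0 + \<delta> * C / (c * \<beta>)"
  proof -
    have "c * \<beta> * w\<^sub>C = c * \<beta> * (c\<^sub>0 + \<delta> * C / (c * \<beta>))"
      using shape by (simp add: w\<^sub>C_def c\<^sub>0_def C_def field_simps) (simp add: \<beta>_def algebra_simps)
    then show ?thesis using shape by simp
  qed
  have gap_sum: "a\<^sub>0 + c\<^sub>0 \<le> w\<^sub>A + w\<^sub>C"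
  proof -
    have "0 \<le> (a + c) * (a - c - \<delta>)" using shape by (simp add: \<beta>_def)
    then have "c * \<beta> \<le> a * \<alpha>" by (simp add: \<alpha>_def \<beta>_def algebra_simps)
    then have "A / (a * \<alpha>) \<le> C / (c * \<beta>)" using AC shape by (intro frac_le) auto
    then have "\<delta> * (A / (a * \<alpha>)) \<le> \<delta> * (C / (c * \<beta>))" using delta_nonneg by (rule mult_left_mono)
    then show ?thesis unfolding gA gC by simp
  qed
  have gap_e2: "a\<^sub>0 * c\<^sub>0 \<le> e\<^sub>2"
  proof -
    have "e\<^sub>2 - a\<^sub>0 * c\<^sub>0 = t * \<delta> * (C - A) / (a * c)"
      using shape unfolding e\<^sub>2_def gA gC by (simp add: a\<^sub>0_def c\<^sub>0_def field_simps)
    also have "\<dots> \<ge> 0" using AC shape t_pos delta_nonneg by simp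
    finally show ?thesis by simp
  qed
  have "K - e\<^sub>2 / 7 \<le> 8 / 343"
  proof -
    define m where "m = (a\<^sub>0 + c\<^sub>0) / 2"
    have m2: "2 * m = a\<^sub>0 + c\<^sub>0" by (simp add: m_def)
    have "K \<le> a\<^sub>0 * c\<^sub>0 * (1 - a\<^sub>0 - c\<^sub>0)"
      unfolding K_def using gap_sum block_bounds by (intro mult_left_mono) auto
    then have "K - e\<^sub>2 / 7 \<le> a\<^sub>0 * c\<^sub>0 * (6/7 - 2 * m)"
      using gap_e2 unfolding m2 by (simp add: algebra_simps)
    also have "\<dots> \<le> 8 / 343"
    proof (cases "0 \<le> 6/7 - 2 * m")
      case True
      have "a\<^sub>0 * c\<^sub>0 \<le> m^2"
        using zero_le_power2[of "a\<^sub>0 - c\<^sub>0"] by (simp add: m_def power2_eq_square field_simps)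
      then have "a\<^sub>0 * c\<^sub>0 * (6/7 - 2 * m) \<le> m^2 * (6/7 - 2 * m)"
        using True by (rule mult_right_mono)
      also have "\<dots> = 8/343 - 2 * (m - 2/7)^2 * (m + 1/7)"
        by (simp add: power2_eq_square field_simps)
      also have "\<dots> \<le> 8/343" using block_bounds by (simp add: m_def)
      finally show ?thesis .
    next
      case False
      then have "a\<^sub>0 * c\<^sub>0 * (6/7 - 2 * m) \<le> 0"
        using block_bounds by (intro mult_nonneg_nonpos) auto
      then show ?thesis by simp
    qed
    finally show ?thesis .
  qed
  \<comment> \<open>\<open>t\<close> is an eigenvalue of the model; its eigenfunction takes the values \<open>a\<close>, \<open>- c\<close>, \<open>\<delta>\<close>.\<close>
  moreover have root: "t^3 - t^2 + t * e\<^sub>2 + K = 0"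
  proof -
    have wAC: "\<alpha> * w\<^sub>A - \<beta> * w\<^sub>C = (t - 1) * \<delta>"
    proof -
      have "\<alpha> * w\<^sub>A = t * \<beta> - \<delta> * p" "\<beta> * w\<^sub>C = t * \<alpha> + \<delta> * q"
        using shape by (simp_all add: w\<^sub>A_def w\<^sub>C_def)
      then show ?thesis using ba by (simp add: b_def algebra_simps)
    qed
    have "a * c * (t^3 - t^2 + t * e\<^sub>2 + K)
        = t^2 * ((t - 1) * (a * c - \<alpha> * \<beta>) + \<alpha> * w\<^sub>A * (a - \<beta>) + \<beta> * w\<^sub>C * (c - \<alpha>))"
      using shape unfolding e\<^sub>2_def K_def a\<^sub>0_def c\<^sub>0_def
      by (simp add: field_simps power2_eq_square power3_eq_cube)
    also have "\<dots> = t^2 * ((a - c - \<delta>) * ((\<alpha> * w\<^sub>A - \<beta> * w\<^sub>C) - (t - 1) * \<delta>))"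
      by (simp add: \<alpha>_def \<beta>_def algebra_simps)
    also have "\<dots> = 0" unfolding wAC by simp
    finally show ?thesis using shape by simp
  qed
  moreover have "(t + 1/7) * (8 * t / 7 - t^2 - 8/49) = t^2 - t^3 - 8/343"
    by Groebner_Basis.algebra
  moreover have "(t + 1/7) * e\<^sub>2 = t * e\<^sub>2 + e\<^sub>2 / 7" by (simp add: distrib_right)
  \<comment> \<open>Eliminating \<open>K\<close> by the root \<open>t\<close> turns \<open>p(- 1/7) \<le> 0\<close> into a lower bound for \<open>e\<^sub>2\<close>.\<close>
  ultimately have "(t + 1/7) * (8 * t / 7 - t^2 - 8/49) \<le> (t + 1/7) * e\<^sub>2" by linarith
  then have low: "8 * t / 7 - t^2 - 8/49 \<le> e\<^sub>2" using t_pos by simp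
  have "(l - t) * (l^2 + l * t + t^2 - l - t + e\<^sub>2) \<le> 0"
    using tent_bound root unfolding e\<^sub>2_def[symmetric] K_def[symmetric]
    by (simp add: power2_eq_square power3_eq_cube algebra_simps)
  moreover have "0 < l - t" using l_gt t_bounds by linarith
  ultimately have "l^2 + l * t + t^2 - l - t + e\<^sub>2 \<le> 0" by (simp add: mult_le_0_iff)
  moreover have "(l + t - 8/7) * (l + 1/7) = l^2 + l * t + t^2 - l - t + (8 * t / 7 - t^2 - 8/49)"
    by Groebner_Basis.algebra
  ultimately have "(l + t - 8/7) * (l + 1/7) \<le> 0" using low by linarith
  then show False using large l_pos by (simp add: mult_le_0_iff)
qed

end

lemma (in weighted_optimum) no_large_optimum: False
proof (rule extreme_vertices)
  fix u v
  assume "u \<in> P" "v \<in> Q" "\<And>i. i \<in> I \<Longrightarrow> z i \<le> z u" "\<And>i. i \<in> I \<Longrightarrow> z v \<le> z i"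
    "nonadj u = Q" "nonadj v = P"
  then interpret extreme_optimum I w x z l t u v by unfold_locales
  show False by (rule no_large_extreme_optimum)
qed

section \<open>Maximising the energy\<close>

definition dot :: "'a set \<Rightarrow> ('a \<Rightarrow> real) \<Rightarrow> ('a \<Rightarrow> real) \<Rightarrow> real" where
  "dot I u v = (\<Sum>i\<in>I. u i * v i)"

definition bil :: "'a set \<Rightarrow> ('a \<Rightarrow> 'a \<Rightarrow> real) \<Rightarrow> ('a \<Rightarrow> real) \<Rightarrow> ('a \<Rightarrow> real) \<Rightarrow> real" where
  "bil I B u v = (\<Sum>i\<in>I. u i * (\<Sum>j\<in>I. B i j * v j))"

definition orthonormal :: "'a set \<Rightarrow> ('a \<Rightarrow> real) \<Rightarrow> ('a \<Rightarrow> real) \<Rightarrow> bool" where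
  "orthonormal I u v \<longleftrightarrow> dot I u u = 1 \<and> dot I v v = 1 \<and> dot I u v = 0"

text \<open>For a fixed orthonormal pair this is the best value of \<open>s i * A i j * s j\<close> summed against
  \<open>u i * u j + v i * v j\<close> over all \<open>A\<close> with entries in \<open>[0, 1]\<close>, that is, of the sum of two Ritz values of a
  graph whose vertices carry the weights \<open>(s i)^2\<close>.\<close>

definition energy :: "'a set \<Rightarrow> ('a \<Rightarrow> real) \<Rightarrow> ('a \<Rightarrow> real) \<Rightarrow> ('a \<Rightarrow> real) \<Rightarrow> real" where
  "energy I s u v = bil I (\<lambda>i j. max 0 (u i * u j + v i * v j)) s s"

lemma dot_comm: "dot I u v = dot I v u"
  by (simp add: dot_def mult.commute)

text \<open>Linear combinations are always written with two explicit coefficients, including \<open>1\<close>, \<open>- 1\<close> and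
  \<open>0\<close>, so that these two rules match as rewrite rules.\<close>

lemma dot_lincomb:
  "dot I u (\<lambda>i. a * v i + b * w i) = a * dot I u v + b * dot I u w"
  "dot I (\<lambda>i. a * v i + b * w i) u = a * dot I v u + b * dot I w u"
  by (simp_all add: dot_def algebra_simps sum.distrib sum_distrib_left)

lemma bil_lincomb:
  "bil I B u (\<lambda>i. a * v i + b * w i) = a * bil I B u v + b * bil I B u w"
  "bil I B (\<lambda>i. a * v i + b * w i) u = a * bil I B v u + b * bil I B w u"
  by (simp_all add: bil_def algebra_simps sum.distrib sum_distrib_left)

lemma bil_alt: "bil I B u v = (\<Sum>i\<in>I. \<Sum>j\<in>I. B i j * (u i * v j))"
  by (simp add: bil_def sum_distrib_left mult_ac)

lemma bil_sym: "(\<And>i j. B i j = B j i) \<Longrightarrow> bil I B u v = bil I B v u"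
  unfolding bil_alt by (subst sum.swap) (simp add: mult.commute)

lemma dot_self_nonneg: "0 \<le> dot I u u"
  by (simp add: dot_def sum_nonneg)

lemma dot_self_eq_0: "finite I \<Longrightarrow> dot I u u = 0 \<longleftrightarrow> (\<forall>i\<in>I. u i = 0)"
  unfolding dot_def by (subst sum_nonneg_eq_0_iff) auto

lemma bil_zero: "(\<forall>i\<in>I. u i = 0) \<Longrightarrow> bil I B u v = 0"
  by (simp add: bil_def)

text \<open>First variation: moving from \<open>\<xi>\<close> in the direction of the residual \<open>r = B \<xi> - \<mu> \<xi>\<close>, which is orthogonal
  to \<open>\<zeta>\<close>, changes the form to first order by twice the squared norm of \<open>r\<close>. With \<open>\<zeta> = 0\<close> this
  covers the unconstrained maximum.\<close>

lemma constrained_maximum_eigenvector: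
  assumes fin: "finite I" and sym: "\<And>i j. B i j = B j i"
    and bound: "\<And>v. dot I v \<zeta> = 0 \<Longrightarrow> bil I B v v \<le> \<mu> * dot I v v"
    and eq: "bil I B \<xi> \<xi> = \<mu> * dot I \<xi> \<xi>"
    and orth: "dot I \<xi> \<zeta> = 0" "bil I B \<zeta> \<xi> = 0"
    and i: "i \<in> I"
  shows "(\<Sum>j\<in>I. B i j * \<xi> j) = \<mu> * \<xi> i"
proof -
  define r where "r i = (\<Sum>j\<in>I. B i j * \<xi> j) - \<mu> * \<xi> i" for i
  have br: "bil I B u \<xi> = dot I u r + \<mu> * dot I u \<xi>" for u
    by (simp add: bil_def dot_def r_def algebra_simps sum_subtractf sum_distrib_left sum.distrib)
  have r\<zeta>: "dot I r \<zeta> = 0" and r\<xi>: "dot I \<xi> r = 0"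
    using br[of \<zeta>] br[of \<xi>] orth eq by (simp_all add: dot_comm)
  have br': "bil I B r \<xi> = dot I r r" "bil I B \<xi> r = dot I r r"
    using br[of r] r\<xi> bil_sym[of B I \<xi> r, OF sym] by (simp_all add: dot_comm)
  have quad: "2 * e * dot I r r + e^2 * (bil I B r r - \<mu> * dot I r r) \<le> 0" for e
  proof -
    let ?v = "\<lambda>i. 1 * \<xi> i + e * r i"
    have "bil I B ?v ?v \<le> \<mu> * dot I ?v ?v"
      by (rule bound) (use dot_lincomb(2)[of I 1 \<xi> e r \<zeta>] orth r\<zeta> in simp)
    then show ?thesis
      unfolding bil_lincomb dot_lincomb br' r\<xi> dot_comm[of I r \<xi>] eq
      by (simp add: algebra_simps power2_eq_square)
  qed
  have "dot I r r = 0"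
  proof (rule ccontr)
    assume "dot I r r \<noteq> 0"
    then have R: "0 < dot I r r" using dot_self_nonneg[of I r] by simp
    define c where "c = \<bar>bil I B r r - \<mu> * dot I r r\<bar> + 1"
    define e where "e = dot I r r / c"
    have c: "0 < c" by (simp add: c_def)
    then have e: "0 < e" using R by (simp add: e_def)
    have "- c \<le> bil I B r r - \<mu> * dot I r r" by (simp add: c_def)
    then have "e^2 * - c \<le> e^2 * (bil I B r r - \<mu> * dot I r r)" by (intro mult_left_mono) auto
    then have "2 * e * dot I r r - e * (e * c) \<le> 0"
      using quad[of e] by (simp add: power2_eq_square)
    moreover have "e * c = dot I r r" using c by (simp add: e_def)
    ultimately have "e * dot I r r \<le> 0" by simp
    then show False using e R by (simp add: mult_le_0_iff)
  qed
  then show ?thesis using dot_self_eq_0[OF fin] i by (auto simp: r_def)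
qed

text \<open>Tychonoff, with all coordinates outside \<open>I\<close> fixed at 0.\<close>

lemma compact_box:
  fixes I :: "'a set"
  shows "compact {f :: 'a \<Rightarrow> real. \<forall>i. f i \<in> (if i \<in> I then {-1..1} else {0})}"
proof -
  have "compactin (product_topology (\<lambda>i. euclidean) UNIV)
      (PiE UNIV (\<lambda>i. if i \<in> I then {-1..1::real} else {0}))"
    by (subst compactin_PiE) auto
  then show ?thesis
    by (simp add: euclidean_product_topology PiE_def Pi_def)
qed

text \<open>Functions on \<open>I\<close> are cut to 0 elsewhere, which changes neither products nor energy; the
  admissible triples then form a compact set in the product topology.\<close>

lemma energy_attains_max:
  fixes I :: "'a set"
  assumes fin: "finite I"
    and start: "dot I s\<^sub>0 s\<^sub>0 = 1" "orthonormal I u\<^sub>0 v\<^sub>0"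
  obtains s u v where "dot I s s = 1" "orthonormal I u v"
    "\<And>s' u' v'. dot I s' s' = 1 \<Longrightarrow> orthonormal I u' v' \<Longrightarrow> energy I s' u' v' \<le> energy I s u v"
proof -
  define Box where "Box = {f :: 'a \<Rightarrow> real. \<forall>i. f i \<in> (if i \<in> I then {-1..1} else {0})}"
  define F where "F = {y :: ('a \<Rightarrow> real) \<times> ('a \<Rightarrow> real) \<times> ('a \<Rightarrow> real).
    dot I (fst y) (fst y) = 1 \<and> dot I (fst (snd y)) (fst (snd y)) = 1
    \<and> dot I (snd (snd y)) (snd (snd y)) = 1 \<and> dot I (fst (snd y)) (snd (snd y)) = 0}"
  define \<psi> where "\<psi> y = energy I (fst y) (fst (snd y)) (snd (snd y))" for y :: "('a \<Rightarrow> real) \<times> ('a \<Rightarrow> real) \<times> ('a \<Rightarrow> real)"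
  have coord: "continuous_on UNIV (\<lambda>y :: ('a \<Rightarrow> real) \<times> ('a \<Rightarrow> real) \<times> ('a \<Rightarrow> real). fst y i)"
    "continuous_on UNIV (\<lambda>y :: ('a \<Rightarrow> real) \<times> ('a \<Rightarrow> real) \<times> ('a \<Rightarrow> real). fst (snd y) i)"
    "continuous_on UNIV (\<lambda>y :: ('a \<Rightarrow> real) \<times> ('a \<Rightarrow> real) \<times> ('a \<Rightarrow> real). snd (snd y) i)" for i
    using continuous_on_product_coordinates[of i]
    by (rule continuous_on_compose2; intro continuous_intros subset_UNIV)+
  have "closed F"
    unfolding F_def dot_def
    by (intro closed_Collect_conj closed_Collect_eq continuous_on_sum continuous_on_mult continuous_on_const coord)
  moreover have "compact (Box \<times> Box \<times> Box)"
    unfolding Box_def by (intro compact_Times compact_box)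
  ultimately have comp: "compact (Box \<times> Box \<times> Box \<inter> F)" by (rule compact_Int_closed[rotated])
  have cont: "continuous_on (Box \<times> Box \<times> Box \<inter> F) \<psi>"
    unfolding \<psi>_def energy_def bil_def
    by (intro continuous_on_sum continuous_on_mult continuous_on_max continuous_on_const continuous_on_add
      coord[THEN continuous_on_subset, OF subset_UNIV])
  define cut where "cut f = (\<lambda>i. if i \<in> I then f i else 0)" for f :: "'a \<Rightarrow> real"
  have cut_box: "cut f \<in> Box" if "dot I f f = 1" for f
  proof -
    have "\<bar>f i\<bar> \<le> 1" if "i \<in> I" for i
    proof -
      have "f i * f i \<le> dot I f f"
        unfolding dot_def using that fin by (intro member_le_sum[of i I "\<lambda>i. f i * f i"]) auto
      then show ?thesis using \<open>dot I f f = 1\<close> by (simp add: abs_square_le_1 power2_eq_square flip: abs_square_le_1)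
    qed
    then show ?thesis by (auto simp: Box_def cut_def abs_le_iff minus_le_iff)
  qed
  have cut_dot: "dot I (cut f) (cut g) = dot I f g" for f g by (simp add: dot_def cut_def)
  have cut_energy: "energy I (cut s) (cut u) (cut v) = energy I s u v" for s u v
    by (simp add: energy_def bil_def cut_def)
  have cutF: "(cut s, cut u, cut v) \<in> Box \<times> Box \<times> Box \<inter> F"
    if "dot I s s = 1" "orthonormal I u v" for s u v
    using that cut_box by (auto simp: F_def cut_dot orthonormal_def)
  then have "Box \<times> Box \<times> Box \<inter> F \<noteq> {}" using start by blast
  from continuous_attains_sup[OF comp this cont] obtain y where
    y: "y \<in> F" and max: "\<And>y'. y' \<in> Box \<times> Box \<times> Box \<inter> F \<Longrightarrow> \<psi> y' \<le> \<psi> y" by auto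
  show ?thesis
  proof (rule that)
    show "dot I (fst y) (fst y) = 1" "orthonormal I (fst (snd y)) (snd (snd y))"
      using y by (auto simp: F_def orthonormal_def)
    fix s' u' v' assume "dot I s' s' = 1" "orthonormal I u' v'"
    from max[OF cutF[OF this]] show "energy I s' u' v' \<le> energy I (fst y) (fst (snd y)) (snd (snd y))"
      by (simp add: \<psi>_def cut_energy)
  qed
qed

text \<open>The point \<open>(p, q)\<close> is at half the angle of \<open>((A - C) / 2, B)\<close>.\<close>

lemma diagonalising_rotation:
  fixes A B C :: real
  obtains p q :: real where "p^2 + q^2 = 1" "p * q * (C - A) + (p^2 - q^2) * B = 0"
proof -
  define d where "d = (A - C) / 2"
  define r where "r = sqrt (d^2 + B^2)"
  show ?thesis
  proof (cases "r = 0")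
    case True
    then have "d = 0" "B = 0" by (auto simp: r_def add_nonneg_eq_0_iff)
    then show ?thesis using that[of 1 0] by (simp add: d_def)
  next
    case False
    then have "(d / r)^2 + (B / r)^2 = 1"
      by (simp add: power_divide r_def flip: add_divide_distrib)
    then obtain \<theta> where th: "d / r = cos \<theta>" "B / r = sin \<theta>"
      using sincos_total_2pi by metis
    have sc: "cos (\<theta>/2) * sin (\<theta>/2) = B / r / 2" using sin_double[of "\<theta>/2"] th by simp
    have cc: "(cos (\<theta>/2))^2 - (sin (\<theta>/2))^2 = d / r" using cos_double[of "\<theta>/2"] th by simp
    have "cos (\<theta>/2) * sin (\<theta>/2) * (C - A) + ((cos (\<theta>/2))^2 - (sin (\<theta>/2))^2) * B = 0"
    proof -
      have "C - A = - (2 * d)" by (simp add: d_def field_simps)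
      then show ?thesis unfolding sc cc by simp
    qed
    then show ?thesis by (intro that[of "cos (\<theta>/2)" "sin (\<theta>/2)"]) simp_all
  qed
qed

text \<open>Entries of \<open>M\<close> are at most 1, so the form is at most the square of \<open>\<Sum>i\<in>J. s i * v i\<close>;
  then apply Cauchy--Schwarz on the support.\<close>

lemma form_le_support:
  assumes fin: "finite I" and s: "\<And>i. i \<in> I \<Longrightarrow> 0 \<le> s i" and v: "\<And>i. i \<in> I \<Longrightarrow> 0 \<le> v i"
    and M: "\<And>i j. M i j \<le> (1::real)"
    and supp: "\<And>i. i \<in> I \<Longrightarrow> i \<notin> J \<Longrightarrow> v i = 0" "J \<subseteq> I"
  shows "bil I (\<lambda>i j. s i * s j * M i j) v v \<le> dot J s s * dot I v v"
proof -
  have "bil I (\<lambda>i j. s i * s j * M i j) v v \<le> (\<Sum>i\<in>I. \<Sum>j\<in>I. (s i * v i) * (s j * v j))"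
    unfolding bil_alt
  proof (intro sum_mono)
    fix i j assume "i \<in> I" "j \<in> I"
    then have "M i j * ((s i * v i) * (s j * v j)) \<le> 1 * ((s i * v i) * (s j * v j))"
      using M s v by (intro mult_right_mono) auto
    then show "s i * s j * M i j * (v i * v j) \<le> (s i * v i) * (s j * v j)" by (simp add: mult_ac)
  qed
  also have "\<dots> = (\<Sum>i\<in>I. s i * v i)^2" by (simp add: sum_product power2_eq_square)
  also have "(\<Sum>i\<in>I. s i * v i) = (\<Sum>i\<in>J. s i * v i)"
    using fin supp by (intro sum.mono_neutral_right) auto
  also have "(\<Sum>i\<in>J. s i * v i)^2 \<le> (\<Sum>i\<in>J. (s i)^2) * (\<Sum>i\<in>J. (v i)^2)"
    by (rule Cauchy_Schwarz_ineq_sum)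
  also have "\<dots> \<le> (\<Sum>i\<in>J. (s i)^2) * (\<Sum>i\<in>I. (v i)^2)"
    using fin supp(2) by (intro mult_left_mono sum_mono2 sum_nonneg) auto
  finally show ?thesis by (simp add: dot_def power2_eq_square)
qed

lemma form_bound_of_unit_bound:
  assumes fin: "finite I"
    and unit: "\<And>y. dot I y y = 1 \<Longrightarrow> dot I y k = 0 \<Longrightarrow> bil I B y y \<le> \<mu>"
    and v: "dot I v k = 0"
  shows "bil I B v v \<le> \<mu> * dot I v v"
proof (cases "dot I v v = 0")
  case True
  then have "bil I B v v = 0" using dot_self_eq_0[OF fin] by (intro bil_zero) blast
  then show ?thesis using True by simp
next
  case False
  define n where "n = sqrt (dot I v v)"
  have n: "n > 0" "n^2 = dot I v v"
    using False dot_self_nonneg[of I v] by (auto simp: n_def order_less_le)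
  define y where "y = (\<lambda>i. (1/n) * v i + 0 * v i)"
  have "dot I y y = 1"
    unfolding y_def dot_lincomb using n False by (simp add: field_simps power2_eq_square)
  moreover have "dot I y k = 0" unfolding y_def dot_lincomb using v by simp
  ultimately have "bil I B y y \<le> \<mu>" by (rule unit)
  then have "bil I B v v / n^2 \<le> \<mu>"
    unfolding y_def bil_lincomb by (simp add: power2_eq_square)
  then have "bil I B v v \<le> \<mu> * n^2" using n(1) by (simp add: divide_le_eq)
  then show ?thesis unfolding n(2) .
qed

text \<open>At a maximum, \<open>(s i)^2\<close>, \<open>\<xi> i / s i\<close>, \<open>\<zeta> i / s i\<close> form a \<open>weighted_optimum\<close>. Let \<open>M\<close> be the 0/1 matrix
  that selects the nonnegative terms of the energy, and \<open>B\<close> its weighted version. For this fixed \<open>B\<close> the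
  maximising pair maximises the trace of \<open>B\<close> over all orthonormal pairs, because the energy dominates the
  trace and agrees with it at the maximum. A rotation of the pair within its plane makes both members
  eigenvectors, and it leaves \<open>\<xi> i * \<xi> j + \<zeta> i * \<zeta> j\<close>, hence \<open>M\<close>, unchanged. For the fixed pair, \<open>s\<close>
  maximises a quadratic form, so it is an eigenvector, too; this is the equation of the ellipse.\<close>

lemma energy_le:
  assumes fin: "finite I" and start: "dot I s\<^sub>0 s\<^sub>0 = 1" "orthonormal I u\<^sub>0 v\<^sub>0"
  shows "energy I s\<^sub>0 u\<^sub>0 v\<^sub>0 \<le> 8/7"
proof (rule ccontr)
  assume "\<not> ?thesis"
  moreover obtain s' \<xi>' \<zeta>' where max': "dot I s' s' = 1" "orthonormal I \<xi>' \<zeta>'"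
    "\<And>s u v. dot I s s = 1 \<Longrightarrow> orthonormal I u v \<Longrightarrow> energy I s u v \<le> energy I s' \<xi>' \<zeta>'"
    using energy_attains_max[OF fin start] by blast
  moreover define S where "S = energy I s' \<xi>' \<zeta>'"
  ultimately have large: "8/7 < S" using start by fastforce
  \<comment> \<open>The kernel of the energy is nonnegative, so \<open>s'\<close> may be replaced by its absolute value.\<close>
  define s where "s i = \<bar>s' i\<bar>" for i
  have s_nonneg: "0 \<le> s i" for i by (simp add: s_def)
  have ss: "dot I s s = 1" using max'(1) by (simp add: s_def dot_def)
  have max: "energy I r u v \<le> S" if "dot I r r = 1" "orthonormal I u v" for r u v
    using max'(3) that by (simp add: S_def)
  have attained: "S \<le> energy I s \<xi>' \<zeta>'"
    unfolding S_def energy_def bil_alt s_def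
    by (intro sum_mono mult_left_mono) (auto simp: abs_mult[symmetric])
  define M where "M i j = (if 0 \<le> \<xi>' i * \<xi>' j + \<zeta>' i * \<zeta>' j then 1 else 0 :: real)" for i j
  define B where "B i j = s i * s j * M i j" for i j
  have B_sym: "B i j = B j i" for i j by (simp add: B_def M_def mult.commute)
  have bs: "bil I B u v = bil I B v u" for u v by (rule bil_sym) (rule B_sym)
  have trace: "bil I B u u + bil I B v v = (\<Sum>i\<in>I. \<Sum>j\<in>I. M i j * (u i * u j + v i * v j) * (s i * s j))" for u v
    by (simp add: bil_alt B_def algebra_simps sum.distrib)
  have trace_le: "bil I B u u + bil I B v v \<le> S" if "orthonormal I u v" for u v
  proof -
    have "bil I B u u + bil I B v v \<le> energy I s u v"
      unfolding trace unfolding energy_def bil_alt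
      using s_nonneg by (intro sum_mono mult_right_mono) (auto simp: M_def)
    then show ?thesis using max[OF ss that] by simp
  qed
  have trace': "S \<le> bil I B \<xi>' \<xi>' + bil I B \<zeta>' \<zeta>'"
  proof -
    have "energy I s \<xi>' \<zeta>' = bil I B \<xi>' \<xi>' + bil I B \<zeta>' \<zeta>'"
      unfolding trace unfolding energy_def bil_alt
      by (intro sum.cong refl) (auto simp: M_def max_def)
    then show ?thesis using attained by simp
  qed

  \<comment> \<open>Diagonalise the quadratic form on the plane of the maximising pair.\<close>
  have "\<exists>\<xi> \<zeta>. orthonormal I \<xi> \<zeta> \<and> (\<forall>i j. \<xi> i * \<xi> j + \<zeta> i * \<zeta> j = \<xi>' i * \<xi>' j + \<zeta>' i * \<zeta>' j)
    \<and> bil I B \<xi> \<zeta> = 0 \<and> bil I B \<zeta> \<zeta> \<le> bil I B \<xi> \<xi>"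
  proof -
    obtain p q where pq: "p^2 + q^2 = 1"
      "p * q * (bil I B \<zeta>' \<zeta>' - bil I B \<xi>' \<xi>') + (p^2 - q^2) * bil I B \<xi>' \<zeta>' = 0"
      by (rule diagonalising_rotation)
    define u where "u = (\<lambda>i. p * \<xi>' i + q * \<zeta>' i)"
    define v where "v = (\<lambda>i. (-q) * \<xi>' i + p * \<zeta>' i)"
    have on: "dot I \<xi>' \<xi>' = 1" "dot I \<zeta>' \<zeta>' = 1" "dot I \<xi>' \<zeta>' = 0" "dot I \<zeta>' \<xi>' = 0"
      using max'(2) by (auto simp: orthonormal_def dot_comm)
    have uv: "orthonormal I u v"
      unfolding orthonormal_def u_def v_def dot_lincomb on using pq(1) by (simp add: power2_eq_square)
    have gram: "u i * u j + v i * v j = \<xi>' i * \<xi>' j + \<zeta>' i * \<zeta>' j" for i j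
    proof -
      have "u i * u j + v i * v j = (p^2 + q^2) * (\<xi>' i * \<xi>' j + \<zeta>' i * \<zeta>' j)"
        by (simp add: u_def v_def power2_eq_square algebra_simps)
      then show ?thesis using pq(1) by simp
    qed
    have "bil I B u v = p * q * (bil I B \<zeta>' \<zeta>' - bil I B \<xi>' \<xi>') + (p^2 - q^2) * bil I B \<xi>' \<zeta>'"
      unfolding u_def v_def bil_lincomb bs[of \<zeta>' \<xi>'] by (simp add: power2_eq_square algebra_simps)
    then have b0: "bil I B u v = 0" using pq(2) by simp
    show ?thesis
    proof (cases "bil I B v v \<le> bil I B u u")
      case True
      then show ?thesis using uv gram b0 by blast
    next
      case False
      then have "bil I B u u \<le> bil I B v v" by simp
      moreover have "orthonormal I v u" using uv by (simp add: orthonormal_def dot_comm)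
      moreover have "bil I B v u = 0" using b0 bs by simp
      ultimately show ?thesis using gram by (metis add.commute)
    qed
  qed
  then obtain \<xi>\<^sub>1 \<zeta>\<^sub>1 where on1: "orthonormal I \<xi>\<^sub>1 \<zeta>\<^sub>1"
    and gram: "\<And>i j. \<xi>\<^sub>1 i * \<xi>\<^sub>1 j + \<zeta>\<^sub>1 i * \<zeta>\<^sub>1 j = \<xi>' i * \<xi>' j + \<zeta>' i * \<zeta>' j"
    and diag: "bil I B \<xi>\<^sub>1 \<zeta>\<^sub>1 = 0" and le1: "bil I B \<zeta>\<^sub>1 \<zeta>\<^sub>1 \<le> bil I B \<xi>\<^sub>1 \<xi>\<^sub>1"
    by blast
  define l where "l = bil I B \<xi>\<^sub>1 \<xi>\<^sub>1"
  define t where "t = bil I B \<zeta>\<^sub>1 \<zeta>\<^sub>1"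
  have on: "dot I \<xi>\<^sub>1 \<xi>\<^sub>1 = 1" "dot I \<zeta>\<^sub>1 \<zeta>\<^sub>1 = 1" "dot I \<xi>\<^sub>1 \<zeta>\<^sub>1 = 0" "dot I \<zeta>\<^sub>1 \<xi>\<^sub>1 = 0"
    using on1 by (auto simp: orthonormal_def dot_comm)
  have lt: "l + t = S"
  proof (rule antisym)
    show "l + t \<le> S" using trace_le[OF on1] by (simp add: l_def t_def)
    have "l + t = bil I B \<xi>' \<xi>' + bil I B \<zeta>' \<zeta>'"
      unfolding l_def t_def trace gram ..
    then show "S \<le> l + t" using trace' by simp
  qed
  have max_\<xi>: "bil I B v v \<le> l * dot I v v" if "dot I v \<zeta>\<^sub>1 = 0" for v
  proof (rule form_bound_of_unit_bound[OF fin _ that])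
    fix y assume "dot I y y = 1" "dot I y \<zeta>\<^sub>1 = 0"
    then have "orthonormal I y \<zeta>\<^sub>1" using on by (simp add: orthonormal_def)
    from trace_le[OF this] show "bil I B y y \<le> l" using lt by (simp add: t_def)
  qed
  have max_\<zeta>: "bil I B v v \<le> t * dot I v v" if "dot I v \<xi>\<^sub>1 = 0" for v
  proof (rule form_bound_of_unit_bound[OF fin _ that])
    fix y assume "dot I y y = 1" "dot I y \<xi>\<^sub>1 = 0"
    then have "orthonormal I \<xi>\<^sub>1 y" using on by (simp add: orthonormal_def dot_comm)
    from trace_le[OF this] show "bil I B y y \<le> t" using lt by (simp add: l_def)
  qed
  have eig_\<xi>: "(\<Sum>j\<in>I. B i j * \<xi>\<^sub>1 j) = l * \<xi>\<^sub>1 i" if "i \<in> I" for i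
    by (rule constrained_maximum_eigenvector[OF fin B_sym max_\<xi> _ _ _ that])
      (use on diag bs in \<open>simp_all add: l_def\<close>)
  have eig_\<zeta>: "(\<Sum>j\<in>I. B i j * \<zeta>\<^sub>1 j) = t * \<zeta>\<^sub>1 i" if "i \<in> I" for i
    by (rule constrained_maximum_eigenvector[OF fin B_sym max_\<zeta> _ _ _ that])
      (use on diag bs in \<open>simp_all add: t_def\<close>)
  have t_le_l: "t \<le> l" using le1 by (simp add: l_def t_def)
  \<comment> \<open>As \<open>t \<le> l\<close>, the bound by \<open>l\<close> extends from the complement of \<open>\<zeta>\<^sub>1\<close> to all vectors.\<close>
  have max_all: "bil I B v v \<le> l * dot I v v" for v
  proof -
    define k where "k = dot I v \<zeta>\<^sub>1"
    define y where "y = (\<lambda>i. 1 * v i + (-k) * \<zeta>\<^sub>1 i)"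
    have b\<zeta>: "bil I B u \<zeta>\<^sub>1 = t * dot I u \<zeta>\<^sub>1" for u
      using eig_\<zeta> by (simp add: bil_def dot_def sum_distrib_left mult_ac)
    have y0: "dot I y \<zeta>\<^sub>1 = 0" unfolding y_def dot_lincomb by (simp add: on k_def)
    have "dot I y y = dot I v v - k^2"
      unfolding y_def dot_lincomb by (simp add: on k_def dot_comm[of I \<zeta>\<^sub>1 v] power2_eq_square)
    moreover have "bil I B y y = bil I B v v - t * k^2"
      unfolding y_def bil_lincomb bs[of \<zeta>\<^sub>1 v] b\<zeta> by (simp add: on k_def power2_eq_square algebra_simps)
    ultimately have "bil I B v v - t * k^2 \<le> l * (dot I v v - k^2)" using max_\<xi>[OF y0] by simp
    moreover have "t * k^2 \<le> l * k^2" using t_le_l by (intro mult_right_mono) auto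
    ultimately show ?thesis by (simp add: algebra_simps)
  qed

  \<comment> \<open>A top eigenvector of mixed sign would split the weight into two parts of weight at least \<open>l\<close>.\<close>
  define pos where "pos i = max (\<xi>\<^sub>1 i) 0" for i
  define neg where "neg i = max (- \<xi>\<^sub>1 i) 0" for i
  have pn: "\<xi>\<^sub>1 = (\<lambda>i. 1 * pos i + (-1) * neg i)" by (auto simp: pos_def neg_def max_def)
  have pn0: "dot I pos neg = 0" by (auto simp: dot_def pos_def neg_def max_def intro!: sum.neutral)
  have pn1: "dot I pos pos + dot I neg neg = 1"
    using on(1) unfolding pn dot_lincomb by (simp add: pn0 dot_comm[of I neg pos])
  have parts: "bil I B pos pos = l * dot I pos pos \<and> bil I B neg neg = l * dot I neg neg"
  proof -
    have b0: "0 \<le> bil I B pos neg"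
      unfolding bil_alt B_def using s_nonneg
      by (intro sum_nonneg mult_nonneg_nonneg) (auto simp: M_def pos_def neg_def)
    have "l = bil I B pos pos + bil I B neg neg - 2 * bil I B pos neg"
      unfolding l_def by (subst (1 2) pn) (simp only: bil_lincomb bs[of neg pos], simp)
    moreover have "l * dot I pos pos + l * dot I neg neg = l"
      using pn1 by (metis distrib_left mult.right_neutral)
    ultimately show ?thesis using b0 max_all[of pos] max_all[of neg] by linarith
  qed
  define I\<^sub>1 where "I\<^sub>1 = {i \<in> I. 0 < \<xi>\<^sub>1 i}"
  define I\<^sub>2 where "I\<^sub>2 = {i \<in> I. \<xi>\<^sub>1 i < 0}"
  have support: "l \<le> dot J s s" if "bil I B v v = l * dot I v v" "dot I v v \<noteq> 0"
    "\<And>i. 0 \<le> v i" "\<And>i. i \<in> I \<Longrightarrow> i \<notin> J \<Longrightarrow> v i = 0" "J \<subseteq> I" for v J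
  proof -
    have "l * dot I v v \<le> dot J s s * dot I v v"
      unfolding that(1)[symmetric] B_def
      using that s_nonneg by (intro form_le_support fin) (auto simp: M_def)
    then show ?thesis using that(2) dot_self_nonneg[of I v] by simp
  qed
  have l1: "l \<le> 1"
  proof -
    have "dot I pos pos \<noteq> 0 \<or> dot I neg neg \<noteq> 0" using pn1 by auto
    then show ?thesis
      using support[of pos I] support[of neg I] parts ss by (auto simp: pos_def neg_def)
  qed
  have one_sign: "dot I pos pos = 0 \<or> dot I neg neg = 0"
  proof (rule ccontr)
    assume "\<not> ?thesis"
    then have "l \<le> dot I\<^sub>1 s s" "l \<le> dot I\<^sub>2 s s"
      using support[of pos I\<^sub>1] support[of neg I\<^sub>2] parts
      by (auto simp: pos_def neg_def I\<^sub>1_def I\<^sub>2_def max_def)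
    moreover have "dot I\<^sub>1 s s + dot I\<^sub>2 s s \<le> dot I s s"
    proof -
      have "dot I\<^sub>1 s s + dot I\<^sub>2 s s = dot (I\<^sub>1 \<union> I\<^sub>2) s s"
        unfolding dot_def using fin by (subst sum.union_disjoint) (auto simp: I\<^sub>1_def I\<^sub>2_def)
      also have "\<dots> \<le> dot I s s"
        unfolding dot_def using fin by (intro sum_mono2) (auto simp: I\<^sub>1_def I\<^sub>2_def)
      finally show ?thesis .
    qed
    ultimately show False using ss t_le_l lt large by linarith
  qed
  \<comment> \<open>Choose the signs of both eigenvectors.\<close>
  define \<epsilon> :: real where "\<epsilon> = (if dot I neg neg = 0 then 1 else -1)"
  define \<eta> :: real where "\<eta> = (if 0 \<le> dot I s \<zeta>\<^sub>1 then 1 else -1)"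
  define \<xi> where "\<xi> i = \<epsilon> * \<xi>\<^sub>1 i" for i
  define \<zeta> where "\<zeta> i = \<eta> * \<zeta>\<^sub>1 i" for i
  have sq: "\<epsilon> * \<epsilon> = 1" "\<eta> * \<eta> = 1" by (auto simp: \<epsilon>_def \<eta>_def)
  have gram': "\<xi> i * \<xi> j + \<zeta> i * \<zeta> j = \<xi>' i * \<xi>' j + \<zeta>' i * \<zeta>' j" for i j
  proof -
    have "\<xi> i * \<xi> j + \<zeta> i * \<zeta> j = (\<epsilon> * \<epsilon>) * (\<xi>\<^sub>1 i * \<xi>\<^sub>1 j) + (\<eta> * \<eta>) * (\<zeta>\<^sub>1 i * \<zeta>\<^sub>1 j)"
      by (simp add: \<xi>_def \<zeta>_def mult_ac)
    then show ?thesis unfolding sq using gram[of i j] by simp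
  qed
  have \<xi>_nonneg: "0 \<le> \<xi> i" if "i \<in> I" for i
  proof (cases "dot I neg neg = 0")
    case True
    then have "neg i = 0" using dot_self_eq_0[OF fin] that by blast
    then have "0 \<le> \<xi>\<^sub>1 i" unfolding neg_def by linarith
    then show ?thesis using True by (simp add: \<xi>_def \<epsilon>_def)
  next
    case False
    then have "pos i = 0" using one_sign dot_self_eq_0[OF fin] that by blast
    then have "\<xi>\<^sub>1 i \<le> 0" unfolding pos_def by linarith
    then show ?thesis using False by (simp add: \<xi>_def \<epsilon>_def)
  qed
  have M_eq: "M i j = (if 0 \<le> \<xi> i * \<xi> j + \<zeta> i * \<zeta> j then 1 else 0)" for i j
    unfolding gram' by (simp add: M_def)
  have eig: "(\<Sum>j\<in>I. B i j * \<xi> j) = l * \<xi> i" "(\<Sum>j\<in>I. B i j * \<zeta> j) = t * \<zeta> i" if "i \<in> I" for i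
  proof -
    have "(\<Sum>j\<in>I. B i j * \<xi> j) = \<epsilon> * (\<Sum>j\<in>I. B i j * \<xi>\<^sub>1 j)" "(\<Sum>j\<in>I. B i j * \<zeta> j) = \<eta> * (\<Sum>j\<in>I. B i j * \<zeta>\<^sub>1 j)"
      by (simp_all add: \<xi>_def \<zeta>_def sum_distrib_left mult_ac)
    then show "(\<Sum>j\<in>I. B i j * \<xi> j) = l * \<xi> i" "(\<Sum>j\<in>I. B i j * \<zeta> j) = t * \<zeta> i"
      unfolding eig_\<xi>[OF that] eig_\<zeta>[OF that] by (simp_all add: \<xi>_def \<zeta>_def)
  qed
  have on': "dot I \<xi> \<xi> = 1" "dot I \<zeta> \<zeta> = 1" "dot I \<xi> \<zeta> = 0"
  proof -
    have "dot I \<xi> \<xi> = (\<epsilon> * \<epsilon>) * dot I \<xi>\<^sub>1 \<xi>\<^sub>1" "dot I \<zeta> \<zeta> = (\<eta> * \<eta>) * dot I \<zeta>\<^sub>1 \<zeta>\<^sub>1"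
      "dot I \<xi> \<zeta> = \<epsilon> * \<eta> * dot I \<xi>\<^sub>1 \<zeta>\<^sub>1"
      by (simp_all add: dot_def \<xi>_def \<zeta>_def mult_ac sum_distrib_left)
    then show "dot I \<xi> \<xi> = 1" "dot I \<zeta> \<zeta> = 1" "dot I \<xi> \<zeta> = 0" unfolding sq by (simp_all add: on)
  qed
  have s\<zeta>: "0 \<le> dot I s \<zeta>"
  proof -
    have "dot I s \<zeta> = \<eta> * dot I s \<zeta>\<^sub>1" by (simp add: dot_def \<zeta>_def sum_distrib_left mult_ac)
    then show ?thesis by (simp add: \<eta>_def)
  qed
  have l0: "0 < l" and t0: "0 < t" using l1 lt large t_le_l by linarith+
  define K where "K = (\<lambda>i j. max 0 (\<xi> i * \<xi> j + \<zeta> i * \<zeta> j))"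
  have weights: "(\<Sum>j\<in>I. K i j * s j) = S * s i" if "i \<in> I" for i
  proof (rule constrained_maximum_eigenvector[OF fin _ _ _ _ _ that, where \<zeta> = "\<lambda>_. 0"])
    show "K i j = K j i" for i j by (simp add: K_def mult.commute)
    have K: "bil I K r r = energy I r \<xi> \<zeta>" for r by (simp add: energy_def K_def)
    have on2: "orthonormal I \<xi> \<zeta>" using on' by (simp add: orthonormal_def)
    show "bil I K r r \<le> S * dot I r r" for r
      by (rule form_bound_of_unit_bound[OF fin, where k = "\<lambda>_. 0"])
        (use max on2 in \<open>simp_all add: K dot_def\<close>)
    have "S \<le> bil I K s s" using attained by (simp add: K energy_def gram')
    moreover have "bil I K s s \<le> S" unfolding K using ss on2 by (rule max)
    ultimately show "bil I K s s = S * dot I s s" using ss by simp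
  qed (simp_all add: dot_def bil_def)
  \<comment> \<open>Vertices of weight 0 carry no part of the eigenvectors and are removed before dividing by \<open>s\<close>.\<close>
  define I' where "I' = {i \<in> I. 0 < s i}"
  have zero: "\<xi> i = 0" "\<zeta> i = 0" if "i \<in> I" "i \<notin> I'" for i
  proof -
    have "s i = 0" using that s_nonneg[of i] by (auto simp: I'_def)
    then have "l * \<xi> i = 0" "t * \<zeta> i = 0" using eig[OF that(1)] by (simp_all add: B_def)
    then show "\<xi> i = 0" "\<zeta> i = 0" using l0 t0 by simp_all
  qed
  have restrict: "(\<Sum>i\<in>I'. f i) = (\<Sum>i\<in>I. f i)" if "\<And>i. i \<in> I \<Longrightarrow> i \<notin> I' \<Longrightarrow> f i = 0" for f :: "'a \<Rightarrow> real"
    using fin that by (intro sum.mono_neutral_left) (auto simp: I'_def)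
  have s_zero: "s i = 0" if "i \<in> I" "i \<notin> I'" for i
    using that s_nonneg[of i] by (auto simp: I'_def)
  have adj_iff: "0 \<le> \<xi> i / s i * (\<xi> j / s j) + \<zeta> i / s i * (\<zeta> j / s j) \<longleftrightarrow> 0 \<le> \<xi> i * \<xi> j + \<zeta> i * \<zeta> j"
    if "i \<in> I'" "j \<in> I'" for i j
  proof -
    have "0 < s i * s j" using that by (simp add: I'_def)
    moreover have "\<xi> i / s i * (\<xi> j / s j) + \<zeta> i / s i * (\<zeta> j / s j) = (\<xi> i * \<xi> j + \<zeta> i * \<zeta> j) / (s i * s j)"
      by (simp add: add_divide_distrib)
    ultimately show ?thesis by (simp add: zero_le_divide_iff)
  qed
  have "weighted_optimum I' (\<lambda>i. (s i)^2) (\<lambda>i. \<xi> i / s i) (\<lambda>i. \<zeta> i / s i) l t"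
  proof
    show "finite I'" using fin by (simp add: I'_def)
    show "0 < (s i)^2" if "i \<in> I'" for i using that by (simp add: I'_def)
    show "0 \<le> \<xi> i / s i" if "i \<in> I'" for i using that \<xi>_nonneg[of i] s_nonneg[of i] by (simp add: I'_def)
    show "(\<Sum>i\<in>I'. (s i)^2) = 1"
      using ss restrict[of "\<lambda>i. (s i)^2"] s_zero by (simp add: dot_def power2_eq_square)
    have I's: "s i \<noteq> 0" if "i \<in> I'" for i using that by (simp add: I'_def)
    have "(\<Sum>i\<in>I'. (s i)^2 * (\<xi> i / s i)^2) = (\<Sum>i\<in>I'. \<xi> i * \<xi> i)"
      by (intro sum.cong refl) (simp add: I's power_divide power2_eq_square)
    then show "(\<Sum>i\<in>I'. (s i)^2 * (\<xi> i / s i)^2) = 1"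
      using on'(1) restrict[of "\<lambda>i. \<xi> i * \<xi> i"] zero by (simp add: dot_def)
    have "(\<Sum>i\<in>I'. (s i)^2 * (\<zeta> i / s i)^2) = (\<Sum>i\<in>I'. \<zeta> i * \<zeta> i)"
      by (intro sum.cong refl) (simp add: I's power_divide power2_eq_square)
    then show "(\<Sum>i\<in>I'. (s i)^2 * (\<zeta> i / s i)^2) = 1"
      using on'(2) restrict[of "\<lambda>i. \<zeta> i * \<zeta> i"] zero by (simp add: dot_def)
    have "(\<Sum>i\<in>I'. (s i)^2 * (\<xi> i / s i * (\<zeta> i / s i))) = (\<Sum>i\<in>I'. \<xi> i * \<zeta> i)"
      by (intro sum.cong refl) (simp add: I's power2_eq_square)
    then show "(\<Sum>i\<in>I'. (s i)^2 * (\<xi> i / s i * (\<zeta> i / s i))) = 0"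
      using on'(3) restrict[of "\<lambda>i. \<xi> i * \<zeta> i"] zero by (simp add: dot_def)
    have row: "k * (f i / s i) = (\<Sum>j\<in>I'. if 0 \<le> \<xi> i / s i * (\<xi> j / s j) + \<zeta> i / s i * (\<zeta> j / s j)
        then (s j)^2 * (f j / s j) else 0)"
      if i: "i \<in> I'" and e: "(\<Sum>j\<in>I. B i j * f j) = k * f i" for i k f
    proof -
      have "(\<Sum>j\<in>I'. if 0 \<le> \<xi> i / s i * (\<xi> j / s j) + \<zeta> i / s i * (\<zeta> j / s j)
          then (s j)^2 * (f j / s j) else 0) = (\<Sum>j\<in>I'. B i j * f j / s i)"
      proof (intro sum.cong refl)
        fix j assume j: "j \<in> I'"
        show "(if 0 \<le> \<xi> i / s i * (\<xi> j / s j) + \<zeta> i / s i * (\<zeta> j / s j)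
          then (s j)^2 * (f j / s j) else 0) = B i j * f j / s i"
          unfolding adj_iff[OF i j] using I's[OF i] I's[OF j]
          by (simp add: B_def M_eq power2_eq_square)
      qed
      also have "\<dots> = (\<Sum>j\<in>I. B i j * f j / s i)"
        using s_zero by (intro restrict) (simp add: B_def)
      also have "\<dots> = k * f i / s i" using e by (simp flip: sum_divide_distrib)
      finally show ?thesis by simp
    qed
    show "l * (\<xi> i / s i) = (\<Sum>j\<in>I'. if 0 \<le> \<xi> i / s i * (\<xi> j / s j) + \<zeta> i / s i * (\<zeta> j / s j)
        then (s j)^2 * (\<xi> j / s j) else 0)" if "i \<in> I'" for i
      using that by (intro row eig) (auto simp: I'_def)
    show "t * (\<zeta> i / s i) = (\<Sum>j\<in>I'. if 0 \<le> \<xi> i / s i * (\<xi> j / s j) + \<zeta> i / s i * (\<zeta> j / s j)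
        then (s j)^2 * (\<zeta> j / s j) else 0)" if "i \<in> I'" for i
      using that by (intro row eig) (auto simp: I'_def)
    show "l * (\<xi> i / s i)^2 + t * (\<zeta> i / s i)^2 = l + t" if i: "i \<in> I'" for i
    proof -
      have iI: "i \<in> I" and si: "s i \<noteq> 0" using i by (auto simp: I'_def)
      have "S * s i * s i = (\<Sum>j\<in>I. K i j * s j) * s i" using weights[OF iI] by simp
      also have "\<dots> = (\<Sum>j\<in>I. \<xi> i * (B i j * \<xi> j) + \<zeta> i * (B i j * \<zeta> j))"
        unfolding sum_distrib_right by (intro sum.cong refl) (auto simp: K_def B_def M_eq max_def algebra_simps)
      also have "\<dots> = \<xi> i * (l * \<xi> i) + \<zeta> i * (t * \<zeta> i)"
        unfolding sum.distrib sum_distrib_left[symmetric] eig[OF iI] ..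
      finally have "l * (\<xi> i)^2 + t * (\<zeta> i)^2 = S * (s i)^2" by (simp add: power2_eq_square algebra_simps)
      then show ?thesis using si by (simp add: lt power_divide add_divide_distrib[symmetric])
    qed
    have "(\<Sum>i\<in>I'. (s i)^2 * (\<zeta> i / s i)) = (\<Sum>i\<in>I'. s i * \<zeta> i)"
      by (intro sum.cong refl) (simp add: power2_eq_square)
    then show "0 \<le> (\<Sum>i\<in>I'. (s i)^2 * (\<zeta> i / s i))"
      using s\<zeta> restrict[of "\<lambda>i. s i * \<zeta> i"] s_zero by (simp add: dot_def)
    show "8/7 < l + t" using large lt by simp
    show "t \<le> l" by (rule t_le_l)
  qed
  then show False by (rule weighted_optimum.no_large_optimum)
qed

section \<open>Spectra of graphs\<close>

text \<open>The summand \<open>0 * f i\<close> gives \<open>\<xi>\<close> the shape required by \<open>dot_lincomb\<close> and \<open>bil_lincomb\<close>.\<close>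

lemma normalised_vector:
  assumes "dot I f f \<noteq> 0"
  defines "\<xi> \<equiv> \<lambda>i. (1 / sqrt (dot I f f)) * f i + 0 * f i"
  shows "dot I \<xi> \<xi> = 1" "bil I B \<xi> \<xi> = bil I B f f / dot I f f"
    "dot I \<xi> g = dot I f g / sqrt (dot I f f)"
proof -
  define n where "n = sqrt (dot I f f)"
  have "0 < dot I f f" using assms dot_self_nonneg[of I f] by simp
  then have n: "n \<noteq> 0" "dot I f f = n * n" by (auto simp: n_def)
  show "dot I \<xi> \<xi> = 1" "bil I B \<xi> \<xi> = bil I B f f / dot I f f"
    "dot I \<xi> g = dot I f g / sqrt (dot I f f)"
    unfolding \<xi>_def n_def[symmetric] dot_lincomb bil_lincomb n(2) using n(1) by (simp_all add: field_simps)
qed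

text \<open>Gram--Schmidt: \<open>f\<close> and the part of \<open>g\<close> orthogonal to \<open>f\<close> span a plane invariant under
  \<open>A\<close>, on which \<open>A\<close> is triangular with diagonal \<open>e\<^sub>1\<close>, \<open>e\<^sub>2\<close>.\<close>

lemma triangular_pair_trace:
  assumes fin: "finite I"
    and f: "\<And>i. i \<in> I \<Longrightarrow> (\<Sum>j\<in>I. A i j * f j) = e\<^sub>1 * f i"
    and g: "\<And>i. i \<in> I \<Longrightarrow> (\<Sum>j\<in>I. A i j * g j) = k * f i + e\<^sub>2 * g i"
    and f0: "\<exists>i\<in>I. f i \<noteq> 0" and indep: "\<And>c. \<exists>i\<in>I. g i \<noteq> c * f i"
  obtains \<xi> \<zeta> where "orthonormal I \<xi> \<zeta>" "bil I A \<xi> \<xi> + bil I A \<zeta> \<zeta> = e\<^sub>1 + e\<^sub>2"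
proof -
  have ff: "dot I f f \<noteq> 0" using dot_self_eq_0[OF fin] f0 by blast
  define c where "c = dot I f g / dot I f f"
  define h where "h = (\<lambda>i. 1 * g i + (- c) * f i)"
  have fh: "dot I f h = 0" unfolding h_def dot_lincomb using ff by (simp add: c_def)
  have hh: "dot I h h \<noteq> 0" using dot_self_eq_0[OF fin, of h] indep[of c] by (auto simp: h_def)
  have bf: "bil I A u f = e\<^sub>1 * dot I u f" for u
    by (simp add: bil_def f) (simp add: dot_def sum_distrib_left mult_ac)
  have bg: "bil I A u g = k * dot I u f + e\<^sub>2 * dot I u g" for u
    by (simp add: bil_def g) (simp add: dot_def sum_distrib_left algebra_simps sum.distrib)
  have "bil I A h h = 1 * bil I A h g + (- c) * bil I A h f" by (subst (2) h_def) (rule bil_lincomb)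
  also have "\<dots> = e\<^sub>2 * dot I h g" using fh by (simp add: bf bg dot_comm)
  also have "dot I h g = dot I h h"
  proof -
    have "dot I h h = 1 * dot I h g + (- c) * dot I h f" by (subst (2) h_def) (rule dot_lincomb)
    then show ?thesis using fh by (simp add: dot_comm)
  qed
  finally have bh: "bil I A h h = e\<^sub>2 * dot I h h" .
  define \<xi> where "\<xi> = (\<lambda>i. (1 / sqrt (dot I f f)) * f i + 0 * f i)"
  define \<zeta> where "\<zeta> = (\<lambda>i. (1 / sqrt (dot I h h)) * h i + 0 * h i)"
  note N = normalised_vector[OF ff, folded \<xi>_def] normalised_vector[OF hh, folded \<zeta>_def]
  have "dot I \<xi> \<zeta> = 0" using N(3)[of \<zeta>] N(6)[of f] fh by (simp add: dot_comm)
  then have "orthonormal I \<xi> \<zeta>" using N(1,4) by (simp add: orthonormal_def)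
  moreover have "bil I A \<xi> \<xi> + bil I A \<zeta> \<zeta> = e\<^sub>1 + e\<^sub>2" unfolding N(2,5) using ff hh bf[of f] bh by simp
  ultimately show ?thesis by (rule that)
qed

lemma splitting_polynomial:
  fixes p :: "'a :: field poly"
  assumes "lead_coeff p = 1" "degree p = length es" "proots p = mset es"
  shows "p = (\<Prod>e\<leftarrow>es. [:- e, 1:])"
  using assms
proof (induction es arbitrary: p)
  case Nil
  then obtain c where "p = [:c:]" by (auto elim: degree_eq_zeroE)
  then show ?case using Nil by (simp add: one_pCons)
next
  case (Cons a es)
  have p0: "p \<noteq> 0" using Cons.prems(1) by auto
  have "a \<in># proots p" using Cons.prems(3) by simp
  then have "[:- a, 1:] dvd p" using p0 by (simp add: poly_eq_0_iff_dvd)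
  then obtain r where r: "p = [:- a, 1:] * r" by (rule dvdE)
  have r0: "r \<noteq> 0" using p0 r by auto
  have "proots p = {#a#} + proots r" unfolding r using r0 by (subst proots_mult) auto
  then have "proots r = mset es" using Cons.prems(3) by simp
  moreover have "lead_coeff r = 1" using Cons.prems(1) unfolding r lead_coeff_mult by simp
  moreover have "degree r = length es"
    using Cons.prems(2) r0 unfolding r by (subst (asm) degree_mult_eq) auto
  ultimately have "r = (\<Prod>e\<leftarrow>es. [:- e, 1:])" using Cons.IH by blast
  then show ?case using r by simp
qed

text \<open>The first two columns of the transforming matrix of a Schur decomposition satisfy the
  hypotheses of \<open>triangular_pair_trace\<close>. They are linearly independent since \<open>Q * P = 1\<close>.\<close>

lemma schur_orthonormal_pair:
  fixes A :: "real mat"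
  assumes A: "A \<in> carrier_mat n n" and cp: "char_poly A = (\<Prod>e\<leftarrow>e\<^sub>1 # e\<^sub>2 # es. [:- e, 1:])"
  obtains \<xi> \<zeta> where "orthonormal {..<n} \<xi> \<zeta>"
    "bil {..<n} (\<lambda>i j. A $$ (i, j)) \<xi> \<xi> + bil {..<n} (\<lambda>i j. A $$ (i, j)) \<zeta> \<zeta> = e\<^sub>1 + e\<^sub>2"
proof -
  obtain B P Q where sd: "schur_decomposition A (e\<^sub>1 # e\<^sub>2 # es) = (B, P, Q)"
    by (metis prod_cases3)
  from schur_decomposition[OF A cp sd] have wit: "similar_mat_wit A B P Q"
    and tri: "upper_triangular B" and diag: "diag_mat B = e\<^sub>1 # e\<^sub>2 # es" by auto
  from similar_mat_witD2[OF A wit] have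
    PQ: "Q * P = 1\<^sub>m n" and ABP: "A = P * B * Q" and B: "B \<in> carrier_mat n n"
    and P: "P \<in> carrier_mat n n" and Q: "Q \<in> carrier_mat n n" by auto
  have n: "2 \<le> n" using arg_cong[OF diag, of length] B by (simp add: diag_mat_def)
  have d: "B $$ (0, 0) = e\<^sub>1" "B $$ (1, 1) = e\<^sub>2"
    using arg_cong[OF diag, of "\<lambda>l. l ! 0"] arg_cong[OF diag, of "\<lambda>l. l ! 1"] B n
    by (simp_all add: diag_mat_def)
  have low: "B $$ (i, j) = 0" if "j < i" "i < n" for i j
    using tri that B by (auto simp: upper_triangular_def)
  have entry: "(X * Y) $$ (i, j) = (\<Sum>m<n. X $$ (i, m) * Y $$ (m, j))"
    if "X \<in> carrier_mat n n" "Y \<in> carrier_mat n n" "i < n" "j < n" for X Y :: "real mat" and i j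
    using that by (simp add: scalar_prod_def atLeast0LessThan)
  have "A * P = P * B * (Q * P)" unfolding ABP using P B Q by (simp add: assoc_mult_mat[of _ n n _ n _ n])
  then have AP: "A * P = P * B" using PQ P B by simp
  have col: "(\<Sum>j<n. A $$ (i, j) * P $$ (j, c)) = (\<Sum>m<n. P $$ (i, m) * B $$ (m, c))"
    if "i < n" "c < n" for i c
    using arg_cong[OF AP, of "\<lambda>X. X $$ (i, c)"] entry[OF A P that] entry[OF P B that] by simp
  have QP: "(\<Sum>m<n. Q $$ (i, m) * P $$ (m, j)) = (if i = j then 1 else 0)" if "i < n" "j < n" for i j
    using entry[OF Q P that] that unfolding PQ by simp
  show ?thesis
  proof (rule triangular_pair_trace[where I = "{..<n}" and A = "\<lambda>i j. A $$ (i, j)"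
        and f = "\<lambda>i. P $$ (i, 0)" and g = "\<lambda>i. P $$ (i, 1)" and k = "B $$ (0, 1)"])
    fix i assume i: "i \<in> {..<n}"
    have "(\<Sum>m<n. P $$ (i, m) * B $$ (m, 0)) = (\<Sum>m\<in>{0}. P $$ (i, m) * B $$ (m, 0))"
      using n low by (intro sum.mono_neutral_right) auto
    then show "(\<Sum>j<n. A $$ (i, j) * P $$ (j, 0)) = e\<^sub>1 * P $$ (i, 0)"
      using col[of i 0] i n d by simp
    have "(\<Sum>m<n. P $$ (i, m) * B $$ (m, 1)) = (\<Sum>m\<in>{0, 1}. P $$ (i, m) * B $$ (m, 1))"
      using n low[of 1] by (intro sum.mono_neutral_right) auto
    then show "(\<Sum>j<n. A $$ (i, j) * P $$ (j, 1)) = B $$ (0, 1) * P $$ (i, 0) + e\<^sub>2 * P $$ (i, 1)"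
      using col[of i 1] i n d by simp
  next
    show "\<exists>i\<in>{..<n}. P $$ (i, 0) \<noteq> 0"
    proof (rule ccontr)
      assume "\<not> ?thesis"
      then have "(\<Sum>m<n. Q $$ (0, m) * P $$ (m, 0)) = 0" by (intro sum.neutral) auto
      then show False using QP[of 0 0] n by simp
    qed
    show "\<exists>i\<in>{..<n}. P $$ (i, 1) \<noteq> c * P $$ (i, 0)" for c
    proof (rule ccontr)
      assume "\<not> ?thesis"
      then have "(\<Sum>m<n. Q $$ (1, m) * P $$ (m, 1)) = c * (\<Sum>m<n. Q $$ (1, m) * P $$ (m, 0))"
        by (simp add: sum_distrib_left mult_ac)
      then show False using QP[of 1 1] QP[of 1 0] n by simp
    qed
  qed (auto intro: that)
qed

text \<open>Dropping the negative terms leaves \<open>n\<close> times the energy with constant \<open>s\<close>.\<close>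

lemma zero_one_trace_le:
  assumes "orthonormal {..<n} \<xi> \<zeta>" and n: "0 < n" and A: "\<And>i j. i < n \<Longrightarrow> j < n \<Longrightarrow> A i j \<in> {0, 1 :: real}"
  shows "bil {..<n} A \<xi> \<xi> + bil {..<n} A \<zeta> \<zeta> \<le> 8/7 * real n"
proof -
  define s :: "nat \<Rightarrow> real" where "s = (\<lambda>_. 1 / sqrt (real n))"
  have ss: "s i * s j = 1 / real n" for i j by (simp add: s_def)
  have "dot {..<n} s s = 1" using n by (simp add: dot_def ss)
  then have e: "energy {..<n} s \<xi> \<zeta> \<le> 8/7" using assms by (intro energy_le) auto
  have "bil {..<n} A \<xi> \<xi> + bil {..<n} A \<zeta> \<zeta> = (\<Sum>i<n. \<Sum>j<n. A i j * (\<xi> i * \<xi> j + \<zeta> i * \<zeta> j))"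
    by (simp add: bil_alt distrib_left sum.distrib)
  also have "\<dots> \<le> (\<Sum>i<n. \<Sum>j<n. max 0 (\<xi> i * \<xi> j + \<zeta> i * \<zeta> j))"
    using A by (intro sum_mono) fastforce
  also have "\<dots> = real n * energy {..<n} s \<xi> \<zeta>"
    using n by (simp add: energy_def bil_alt ss flip: sum_divide_distrib)
  also have "\<dots> \<le> real n * (8/7)" using e by (intro mult_left_mono) auto
  finally show ?thesis by simp
qed

theorem theorem1p2:
  fixes G :: "('a, 'b) pre_digraph" and n :: nat
  assumes "n \<ge> 2"
    and "graph G"
    and "card (verts G) = n"
  shows "graph_eigenvalue G 1 + graph_eigenvalue G 2 \<le> 8 / 7 * real n"
proof -
  interpret graph G by fact
  obtain vs where vs: "enumerates_verts G vs"
    using finite_distinct_list[OF finite_verts] by (auto simp: enumerates_verts_def)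
  define A where "A = adjacency_matrix G vs"
  have len: "length vs = n" using vs assms(3) by (metis enumerates_verts_def distinct_card)
  have A: "A \<in> carrier_mat n n" using adjacency_matrix_carrier[of G vs] by (simp add: A_def len)
  have proots: "proots (char_poly A) = mset (graph_spectrum G)"
    unfolding graph_spectrum_eq[OF vs] A_def by simp
  have length: "length (graph_spectrum G) = n" using length_graph_spectrum[OF assms(2)] assms(3) by simp
  obtain e\<^sub>1 e\<^sub>2 es where spec: "graph_spectrum G = e\<^sub>1 # e\<^sub>2 # es"
    using length assms(1) by (metis One_nat_def Suc_1 Suc_le_length_iff)
  have "char_poly A = (\<Prod>e\<leftarrow>graph_spectrum G. [:- e, 1:])"
    using degree_monic_char_poly[OF A] length proots by (intro splitting_polynomial) auto
  then have cp: "char_poly A = (\<Prod>e\<leftarrow>e\<^sub>1 # e\<^sub>2 # es. [:- e, 1:])" by (simp only: spec)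
  obtain \<xi> \<zeta> where "orthonormal {..<n} \<xi> \<zeta>"
    and tr: "bil {..<n} (\<lambda>i j. A $$ (i, j)) \<xi> \<xi> + bil {..<n} (\<lambda>i j. A $$ (i, j)) \<zeta> \<zeta> = e\<^sub>1 + e\<^sub>2"
    by (rule schur_orthonormal_pair[OF A cp])
  then have "e\<^sub>1 + e\<^sub>2 \<le> 8/7 * real n"
    unfolding tr[symmetric] using assms(1)
    by (intro zero_one_trace_le) (auto simp: A_def adjacency_matrix_def len)
  then show ?thesis by (simp add: graph_eigenvalue_def spec)
qed

end
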